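(* Let $\hat c$ be sufficiently large ($\hat c>8$ is large enough). Then the quadrature weights $\lambda_{k,3n}^{(1)}$ of the first integral $\int_{-\infty}^\infty f(x)e^{-n(x^2+\hat cx)}\,dx$ satisfy \[ \lambda_{k,3n}^{(1)}>0,\qquad 1\le k\le n, \] and \[ \operatorname{sign}\lambda_{k,3n}^{(1)}=(-1)^{k-n+1},\qquad n+1\le k\le 3n. \]
   Context: Let $n\ge1$, $V_1(x)=x^2+\hat cx$, $V_2(x)=x^2$, $V_3(x)=x^2-\hat cx$. Let $P_{3n}$ be the scaled multiple Hermite polynomial, i.e. the unique monic polynomial of degree $3n$ with $\int_{-\infty}^\infty x^kP_{3n}(x)e^{-nV_j(x)}dx=0$ for $0\le k\le n-1$, $j=1,2,3$. It has $3n$ simple real zeros $x_{1,3n}<\dots<x_{3n,3n}$. The quadrature weights $\lambda_{k,3n}^{(1)}$, $1\le k\le 3n$, are the unique real numbers such that $\int_{-\infty}^\infty f(x)e^{-n(x^2+\hat cx)}dx=\sum_{k=1}^{3n}\lambda_{k,3n}^{(1)}f(x_{k,3n})$ for all polynomials $f$ of degree $\le 4n-1$. *)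

theory Defs
  imports "HOL-Analysis.Analysis" "HOL-Computational_Algebra.Polynomial"
begin

definition potential :: "real \<Rightarrow> nat \<Rightarrow> real \<Rightarrow> real" where
  "potential c j x =
     (if j = 1 then x\<^sup>2 + c * x
      else if j = 2 then x\<^sup>2
      else x\<^sup>2 - c * x)"

text \<open>
  The scaled multiple Hermite polynomial of degree \<open>3 n\<close>. The defining conditions determine
  it uniquely, so it is given as a predicate on polynomials instead of by a choice operator.
  All integrands below are polynomials times Gaussians, hence integrable.
\<close>

definition scaled_multiple_hermite :: "real \<Rightarrow> nat \<Rightarrow> real poly \<Rightarrow> bool" where
  "scaled_multiple_hermite c n P \<longleftrightarrow>
     degree P = 3 * n \<and> lead_coeff P = 1 \<and>
     (\<forall>j\<in>{1..3}. \<forall>k<n.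
        (LINT x|lborel. x ^ k * poly P x * exp (- real n * potential c j x)) = 0)"

text \<open>
  \<open>x 1 < ... < x m\<close> are all the (real) zeros of \<open>P\<close>; when \<open>m = degree P\<close>,
  they are therefore simple and there are no others in the complex plane.
\<close>

definition ordered_zeros :: "real poly \<Rightarrow> nat \<Rightarrow> (nat \<Rightarrow> real) \<Rightarrow> bool" where
  "ordered_zeros P m x \<longleftrightarrow>
     strict_mono_on {1..m} x \<and> x ` {1..m} = {z. poly P z = 0}"

text \<open>
  Weights, at the nodes \<open>x 1, ..., x (3 n)\<close>, of the quadrature rule for the first integral. Exactness in degree
  \<open>\<le> 3 n - 1\<close> at distinct nodes already determines them.
\<close>

definition first_quadrature_weights ::
    "real \<Rightarrow> nat \<Rightarrow> (nat \<Rightarrow> real) \<Rightarrow> (nat \<Rightarrow> real) \<Rightarrow> bool" where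
  "first_quadrature_weights c n x w \<longleftrightarrow>
     (\<forall>f :: real poly. degree f \<le> 4 * n - 1 \<longrightarrow>
        (LINT t|lborel. poly f t * exp (- real n * potential c 1 t)) =
        (\<Sum>k = 1..3 * n. w k * poly f (x k)))"

end

theory Submission
  imports Defs "HOL-Probability.Distributions" "HOL-Real_Asymp.Real_Asymp"
begin

text \<open>
  Centre coordinates at one of the points \<open>-c/2\<close>, \<open>0\<close>, \<open>c/2\<close>, so that the weight is
  \<open>exp (-n t^2)\<close>. If \<open>A\<close> has degree at most \<open>n\<close>, then \<open>A^2\<close> times this weight has most of its
  mass on \<open>|t| <= 17/10\<close>: expand \<open>A\<close> in Hermite polynomials and use Cauchy--Schwarz together
  with \<open>|H_k(t)| <= |t|^k\<close> for \<open>t^2 >= 2\<close>, \<open>k <= n\<close>. If moreover \<open>R\<close> has at most \<open>3 n\<close> zeros,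
  either all \<open>>= 2\<close> or symmetric about \<open>0\<close> and all outside \<open>(-2, 2)\<close>, then the possibly wrong
  sign of \<open>R\<close> on \<open>|t| >= 2\<close> cannot compensate for this mass, and the integral of \<open>A^2 R\<close> has
  the sign of \<open>R(0)\<close>.

  Let \<open>A\<close> be the factor of \<open>P\<close> with the zeros to the left of \<open>2 - c/2\<close> (or, for the middle
  centre, those in \<open>(-2, 2)\<close>) and \<open>R\<close> the complementary factor: if there were fewer than \<open>n\<close>
  such zeros, the integral of \<open>A^2 R = A P\<close> would vanish by orthogonality. The middle centre and
  the zeros to the right of \<open>c/2 - 2\<close> use that \<open>P\<close> is even or odd, which follows from uniqueness.
  As \<open>c > 8\<close> the three regions are disjoint, so each contains exactly \<open>n\<close> zeros and
  \<open>x (n + 1), ...\<close> are at least \<open>2 - c/2\<close>. Finally the sign of \<open>w k\<close> is read off by applying the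
  quadrature rule to \<open>A^2 R\<close>, where \<open>A\<close> has zeros \<open>x 1, ..., x n\<close> and \<open>R\<close> has zeros
  \<open>x (n + 1), ..., x (3 n)\<close>, with \<open>x k\<close> left out.
\<close>

subsection \<open>Gaussian means and Hermite polynomials\<close>

locale gaussian_weight =
  fixes N :: real
  assumes N_pos: "N > 0"
begin

text \<open>The factor \<open>sqrt (N / pi)\<close> makes this the normal density of variance
  \<open>1 / (2 * N)\<close>, so the known normal moments apply and constants are their own
  mean.\<close>

definition weight :: "real \<Rightarrow> real" where
  "weight t = sqrt (N / pi) * exp (- N * t\<^sup>2)"

definition mean :: "real poly \<Rightarrow> real" where
  "mean f = (LINT t|lborel. poly f t * weight t)"

lemma weight_pos: "weight t > 0"
  using N_pos by (simp add: weight_def)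

lemma weight_measurable [measurable]: "weight \<in> borel_measurable borel"
  unfolding weight_def[abs_def] by measurable

lemma weight_eq_normal_density: "weight t = normal_density 0 (sqrt (1 / (2 * N))) t"
proof -
  have "1 / sqrt (2 * pi * (1 / (2 * N))) = sqrt (N / pi)"
    using N_pos by (simp add: real_sqrt_divide)
  moreover have "- (t\<^sup>2) / (2 * (1 / (2 * N))) = - N * t\<^sup>2"
    using N_pos by (simp add: field_simps)
  ultimately show ?thesis
    using N_pos by (simp add: weight_def normal_density_def)
qed

lemma poly_measurable [measurable]: "poly (f :: real poly) \<in> borel_measurable borel"
  by (intro borel_measurable_continuous_onI continuous_intros)

lemma integrable_power: "integrable lborel (\<lambda>t. t ^ k * weight t)"
  using integrable_normal_moment[of "sqrt (1 / (2 * N))" 0 k] N_pos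
  by (simp add: weight_eq_normal_density mult.commute)

lemma integrable_poly: "integrable lborel (\<lambda>t. poly f t * weight t)"
  unfolding poly_altdef
  by (simp add: sum_distrib_right mult.assoc integrable_power)

lemma mean_add: "mean (f + g) = mean f + mean g"
  unfolding mean_def by (simp add: distrib_right integrable_poly)

lemma mean_smult: "mean (smult c f) = c * mean f"
  unfolding mean_def by (simp add: mult.assoc)

lemma mean_diff: "mean (f - g) = mean f - mean g"
  unfolding mean_def by (simp add: left_diff_distrib integrable_poly)

lemma mean_0 [simp]: "mean 0 = 0"
  unfolding mean_def by simp

lemma mean_sum: "mean (sum f A) = (\<Sum>i\<in>A. mean (f i))"
  by (induction A rule: infinite_finite_induct) (simp_all add: mean_add)

lemma mean_even_power: "mean (monom 1 (2 * k)) = fact (2 * k) / ((4 * N) ^ k * fact k)"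
proof -
  have "(2 / (sqrt (1 / (2 * N)))\<^sup>2) = 4 * N"
    using N_pos by simp
  then show ?thesis
    using integral_normal_moment_even[of "sqrt (1 / (2 * N))" 0 k] N_pos
    by (simp add: mean_def weight_eq_normal_density poly_monom mult.commute)
qed

lemma mean_odd_power: "mean (monom 1 (2 * k + 1)) = 0"
  using integral_normal_moment_odd[of "sqrt (1 / (2 * N))" 0 k] N_pos
  by (simp add: mean_def weight_eq_normal_density poly_monom mult.commute)

lemma mean_const [simp]: "mean [:c:] = c"
  using mean_even_power[of 0] mean_smult[of c "[:1:]"] by (simp add: monom_0)

lemma mean_1 [simp]: "mean 1 = 1"
  by (simp add: one_pCons)

text \<open>Stein's identity (Gaussian integration by parts) for monomials, read off the explicit
  even and odd moments.\<close>

lemma mean_monom_Suc: "mean (monom 1 (Suc k)) = (1 / (2 * N)) * mean (pderiv (monom 1 k))"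
proof (cases "even k")
  case True
  then obtain j where k: "k = 2 * j" by blast
  show ?thesis
  proof (cases j)
    case 0
    then show ?thesis using mean_odd_power[of 0] k by (simp add: pderiv_monom)
  next
    case (Suc i)
    have "pderiv (monom 1 k) = smult (real k) (monom (1::real) (2 * i + 1))"
      using k Suc by (simp add: pderiv_monom smult_monom)
    then show ?thesis using mean_odd_power[of j] mean_odd_power[of i] k
      by (simp add: mean_smult)
  qed
next
  case False
  then obtain j where k: "k = 2 * j + 1" by (blast elim: oddE)
  have "pderiv (monom 1 k) = smult (real k) (monom (1::real) (2 * j))"
    using k by (simp add: pderiv_monom smult_monom)
  moreover have "Suc k = 2 * Suc j" using k by simp
  ultimately show ?thesis
    using N_pos
    by (simp only: mean_smult mean_even_power k, simp add: divide_simps)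
qed

lemma mean_pCons_0: "mean (pCons 0 f) = (1 / (2 * N)) * mean (pderiv f)"
proof -
  have "[:0, 1:] * monom c i = smult c (monom 1 (Suc i))" for c :: real and i
    by (simp add: monom_Suc smult_monom)
  moreover have "pCons 0 f = [:0, 1:] * (\<Sum>i\<le>degree f. monom (coeff f i) i)"
    by (simp add: poly_as_sum_of_monoms)
  ultimately have "pCons 0 f = (\<Sum>i\<le>degree f. smult (coeff f i) (monom 1 (Suc i)))"
    by (simp only: sum_distrib_left)
  moreover have "pderiv f = (\<Sum>i\<le>degree f. smult (coeff f i) (pderiv (monom 1 i)))"
    by (subst (1) poly_as_sum_of_monoms[of f, symmetric])
      (simp add: higher_pderiv_sum[where n = 1, simplified] smult_monom flip: pderiv_smult)
  ultimately show ?thesis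
    by (simp only: mean_sum mean_smult mean_monom_Suc sum_distrib_left) (simp add: mult_ac)
qed

text \<open>Mean zero would make \<open>f\<close> vanish almost everywhere, but its zero set is
  finite and hence null.\<close>

lemma mean_square_pos:
  assumes "f \<noteq> 0"
  shows "mean (f\<^sup>2) > 0"
proof -
  have "mean (f\<^sup>2) \<noteq> 0"
  proof
    assume "mean (f\<^sup>2) = 0"
    then have "AE t in lborel. poly (f\<^sup>2) t * weight t = 0"
      unfolding mean_def using integrable_poly[of "f\<^sup>2"] weight_pos
      by (subst (asm) integral_nonneg_eq_0_iff_AE) (auto intro!: AE_I2 mult_nonneg_nonneg simp: less_imp_le)
    then have "AE t in lborel. t \<in> {t. poly f t = 0}"
      by eventually_elim (use weight_pos in \<open>auto simp: less_le\<close>)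
    moreover have "{t. poly f t = 0} \<in> null_sets lborel"
      using assms by (intro countable_imp_null_set_lborel countable_finite poly_roots_finite)
    then have "AE t in lborel. t \<notin> {t. poly f t = 0}"
      by (rule AE_not_in)
    ultimately have "AE t in (lborel :: real measure). False"
      by eventually_elim auto
    then show False
      by (simp add: eventually_False ae_filter_eq_bot_iff)
  qed
  moreover have "mean (f\<^sup>2) \<ge> 0"
    unfolding mean_def using weight_pos by (auto intro!: integral_nonneg_AE mult_nonneg_nonneg simp: less_imp_le)
  ultimately show ?thesis by simp
qed

text \<open>These are the monic rescalings \<open>H_k (sqrt N * t) / (2 * sqrt N) ^ k\<close> of the
  physicists' Hermite polynomials. The raising operator is chosen as recursion because it is the
  adjoint of \<open>pderiv\<close> divided by \<open>2 * N\<close>.\<close>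

fun hermite :: "nat \<Rightarrow> real poly" where
  "hermite 0 = 1"
| "hermite (Suc k) = pCons 0 (hermite k) - smult (1 / (2 * N)) (pderiv (hermite k))"

text \<open>The Appell property: after differentiating the recursion, the induction hypothesis turns
  the last two terms into a multiple of the raising operator again.\<close>

lemma pderiv_hermite_Suc: "pderiv (hermite (Suc k)) = smult (real (Suc k)) (hermite k)"
proof (induction k)
  case (Suc k)
  have "pderiv (hermite (Suc (Suc k))) =
    hermite (Suc k) + pCons 0 (pderiv (hermite (Suc k)))
      - smult (1 / (2 * N)) (pderiv (pderiv (hermite (Suc k))))"
    by (subst hermite.simps(2)) (simp only: pderiv_diff pderiv_smult pderiv_pCons)
  also have "\<dots> = hermite (Suc k) + smult (real (Suc k)) (hermite (Suc k))"
    by (simp only: Suc pderiv_smult) (simp add: algebra_simps smult_diff_right)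
  also have "\<dots> = smult (1 + real (Suc k)) (hermite (Suc k))"
    by (simp only: smult_add_left smult_1_left)
  finally show ?case by (simp only: of_nat_Suc)
qed (simp add: pderiv_pCons pderiv_diff)

lemma degree_hermite_le: "degree (hermite k) \<le> k"
  and coeff_hermite: "coeff (hermite k) k = 1"
proof (induction k)
  case (Suc k)
  {
    case 1
    show ?case
      using Suc degree_pderiv[of "hermite k"]
      by (auto intro!: degree_diff_le order_trans[OF degree_smult_le] order_trans[OF degree_pCons_le])
  next
    case 2
    have "degree (hermite k) < Suc (Suc k)" using Suc(1) by simp
    then show ?case
      using Suc(2) by (simp add: coeff_pderiv coeff_eq_0)
  }
qed simp_all

text \<open>Integration by parts \<open>k\<close> times: each raising operator moves over to
  \<open>f\<close> as a derivative.\<close>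

lemma mean_mult_hermite: "mean (f * hermite k) = (1 / (2 * N)) ^ k * mean ((pderiv ^^ k) f)"
proof (induction k arbitrary: f)
  case (Suc k)
  have "mean (f * hermite (Suc k)) =
    mean (pCons 0 (f * hermite k)) - (1 / (2 * N)) * mean (f * pderiv (hermite k))"
    by (simp add: right_diff_distrib mean_diff mean_smult)
  also have "\<dots> = (1 / (2 * N)) * mean (pderiv f * hermite k)"
    by (subst mean_pCons_0) (simp add: pderiv_mult mean_add algebra_simps)
  also have "\<dots> = (1 / (2 * N)) ^ Suc k * mean ((pderiv ^^ Suc k) f)"
    by (subst Suc) (simp add: funpow_swap1)
  finally show ?case .
qed simp

lemma higher_pderiv_hermite_self: "(pderiv ^^ k) (hermite k) = smult (fact k) 1"
proof (induction k)
  case (Suc k)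
  have "(pderiv ^^ Suc k) (hermite (Suc k)) = (pderiv ^^ k) (smult (real (Suc k)) (hermite k))"
    by (simp only: funpow_Suc_right o_apply pderiv_hermite_Suc)
  then show ?case
    by (simp add: higher_pderiv_smult Suc)
qed simp

lemma mean_hermite_hermite:
  "mean (hermite j * hermite k) = (if j = k then fact k / (2 * N) ^ k else 0)"
proof -
  have less: "mean (hermite j * hermite k) = 0" if "j < k" for j k
  proof -
    have "(pderiv ^^ k) (hermite j) = 0"
      using that degree_hermite_le[of j] by (intro poly_eqI) (simp add: coeff_higher_pderiv coeff_eq_0)
    then show ?thesis by (simp add: mean_mult_hermite)
  qed
  show ?thesis
    using less[of j k] less[of k j]
    by (cases j k rule: linorder_cases)
      (simp_all add: mult.commute mean_mult_hermite higher_pderiv_hermite_self mean_smult power_one_over field_simps del: One_nat_def)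
qed

lemma hermite_expansion:
  assumes "degree f \<le> m"
  shows "\<exists>g. f = (\<Sum>k\<le>m. smult (g k) (hermite k))"
  using assms
proof (induction m arbitrary: f)
  case 0
  then show ?case by (auto elim!: degree_eq_zeroE)
next
  case (Suc m)
  define c where "c = coeff f (Suc m)"
  have "degree (f - smult c (hermite (Suc m))) \<le> m"
  proof (rule degree_le, intro allI impI)
    fix i assume "m < i"
    then consider "i = Suc m" | "i > Suc m" by linarith
    then show "coeff (f - smult c (hermite (Suc m))) i = 0"
    proof cases
      case 1
      then show ?thesis by (simp add: c_def coeff_hermite del: hermite.simps)
    next
      case 2
      then show ?thesis using Suc.prems degree_hermite_le[of "Suc m"]
        by (simp add: coeff_eq_0 del: hermite.simps)
    qed
  qed
  then obtain g where g: "f - smult c (hermite (Suc m)) = (\<Sum>k\<le>m. smult (g k) (hermite k))"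
    using Suc.IH by blast
  have "f = (\<Sum>k\<le>Suc m. smult ((g(Suc m := c)) k) (hermite k))"
    using g by (simp add: algebra_simps del: hermite.simps)
  then show ?case by blast
qed

text \<open>The three-term recurrence: the Appell property removes the derivative from the
  recursion.\<close>

lemma hermite_Suc_Suc: "poly (hermite (Suc (Suc k))) t =
    t * poly (hermite (Suc k)) t - real (Suc k) / (2 * N) * poly (hermite k) t"
  by (subst hermite.simps(2)) (simp add: pderiv_hermite_Suc del: hermite.simps)

end

subsection \<open>Growth of polynomials relative to their Gaussian norm\<close>

text \<open>The quotient of consecutive values of \<open>n ^ n / fact n\<close> is
  \<open>(1 + 1 / n) ^ n\<close>, which is at most \<open>exp 1\<close>.\<close>

lemma self_power_le_fact:
  assumes "n \<ge> 1"
  shows "real n ^ n \<le> exp (real n - 1) * fact n"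
  using assms
proof (induction n rule: dec_induct)
  case (step n)
  have n: "real n > 0" using step by simp
  have "(1 + 1 / real n) ^ n \<le> exp 1"
    using exp_ge_one_plus_x_over_n_power_n[of n 1] step by simp
  then have "real (Suc n) ^ n \<le> exp 1 * real n ^ n"
    using n by (simp add: field_simps flip: power_divide) (simp add: field_simps power_divide)
  also have "\<dots> \<le> exp 1 * (exp (real n - 1) * fact n)"
    using step by (intro mult_left_mono) auto
  also have "\<dots> = exp (real (Suc n) - 1) * fact n"
    by (simp add: exp_diff)
  finally have "real (Suc n) * real (Suc n) ^ n \<le> real (Suc n) * (exp (real (Suc n) - 1) * fact n)"
    by (rule mult_left_mono) simp
  then show ?case by (simp add: mult_ac)
qed simp

text \<open>Each term is at least \<open>289 / 50 = 2 * (17 / 10)^2\<close> times the one before, so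
  the last term dominates as in a geometric series;
  \<open>1 / (1 - 50 / 289) < 121 / 100\<close>.\<close>

lemma exp_partial_sum_le:
  fixes y :: real
  assumes "y \<ge> 289 / 50 * real n" "k \<le> n"
  shows "(\<Sum>j\<le>k. y ^ j / fact j) \<le> 121 / 100 * (y ^ k / fact k)"
  using assms(2)
proof (induction k)
  case (Suc k)
  have "289 / 50 * real (Suc k) \<le> 289 / 50 * real n" using Suc by simp
  then have y: "289 / 50 * real (Suc k) \<le> y" using assms by linarith
  then have y0: "y > 0" by (rule less_le_trans[rotated]) simp
  have "289 / 50 * real (Suc k) * (y ^ k / fact (Suc k)) \<le> y * (y ^ k / fact (Suc k))"
    using y y0 by (intro mult_right_mono) auto
  then have a: "289 / 50 * (y ^ k / fact k) \<le> y ^ Suc k / fact (Suc k)"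
    by (simp add: field_simps del: of_nat_Suc)
  have b: "(\<Sum>j\<le>k. y ^ j / fact j) \<le> 121 / 100 * (y ^ k / fact k)"
    using Suc by simp
  have c: "S + B \<le> 121 / 100 * B" if "289 / 50 * A \<le> B" "S \<le> 121 / 100 * A" "B \<ge> 0" for S A B :: real
    using that by linarith
  show ?case unfolding sum.atMost_Suc by (rule c[OF a b]) (use y0 in simp)
qed simp

context gaussian_weight
begin

text \<open>Cauchy--Schwarz for the coefficients in the normalised Hermite basis. The sum is the
  reproducing (Christoffel--Darboux) kernel on the diagonal.\<close>

lemma poly_square_le:
  assumes "degree f \<le> m"
  shows "(poly f t)\<^sup>2 \<le> mean (f\<^sup>2) * (\<Sum>k\<le>m. (poly (hermite k) t)\<^sup>2 * ((2 * N) ^ k / fact k))"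
proof -
  obtain g where g: "f = (\<Sum>k\<le>m. smult (g k) (hermite k))"
    using hermite_expansion[OF assms] by blast
  \<comment> \<open>\<open>c k\<close> is the norm of \<open>hermite k\<close>.\<close>
  define c where "c k = sqrt (fact k / (2 * N) ^ k)" for k
  have c: "c k > 0" "(c k)\<^sup>2 = fact k / (2 * N) ^ k" for k
    using N_pos by (simp_all add: c_def)
  have "mean (f\<^sup>2) = (\<Sum>j\<le>m. \<Sum>k\<le>m. g j * (g k * mean (hermite j * hermite k)))"
    by (simp add: g power2_eq_square sum_product mean_sum mean_smult mult_ac)
  also have "\<dots> = (\<Sum>k\<le>m. (g k * c k)\<^sup>2)"
    by (simp add: mean_hermite_hermite if_distrib sum.delta cong: if_cong)
      (simp add: power_mult_distrib c, simp add: power2_eq_square mult.assoc)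
  finally have norm: "mean (f\<^sup>2) = (\<Sum>k\<le>m. (g k * c k)\<^sup>2)" .
  have "(poly f t)\<^sup>2 = (\<Sum>k\<le>m. (g k * c k) * (poly (hermite k) t / c k))\<^sup>2"
    using c(1) by (simp add: g poly_sum less_imp_neq[symmetric])
  also have "\<dots> \<le> (\<Sum>k\<le>m. (g k * c k)\<^sup>2) * (\<Sum>k\<le>m. (poly (hermite k) t / c k)\<^sup>2)"
    by (rule Cauchy_Schwarz_ineq_sum)
  finally show ?thesis
    by (simp add: norm power_divide c)
qed

text \<open>For \<open>u j = hermite j (t) / t ^ j\<close> the recurrence subtracts at most
  \<open>u j / 4\<close> from \<open>u (Suc j)\<close>. If \<open>u (Suc j)\<close> is at least
  \<open>u j / 2\<close>, this is at most half of it, so \<open>u\<close> stays positive and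
  decreases from 1.\<close>

lemma hermite_square_le:
  assumes t: "t\<^sup>2 \<ge> 2" and k: "real k \<le> N"
  shows "(poly (hermite k) t)\<^sup>2 \<le> (t\<^sup>2) ^ k"
proof -
  define u where "u j = poly (hermite j) t / t ^ j" for j
  have t0: "t \<noteq> 0" using t by auto
  have rec: "u (Suc (Suc j)) = u (Suc j) - real (Suc j) / (2 * N * t\<^sup>2) * u j" for j
    unfolding u_def hermite_Suc_Suc using t0 N_pos
    by (simp add: field_simps power2_eq_square del: of_nat_Suc hermite.simps)
  have "u k > 0 \<and> u k \<le> 1 \<and> u (Suc k) \<le> u k \<and> u (Suc k) \<ge> u k / 2"
    using k
  proof (induction k)
    case 0
    then show ?case using t0 by (simp add: u_def)
  next
    case (Suc k)
    then have IH: "u k > 0" "u k \<le> 1" "u (Suc k) \<le> u k" "u (Suc k) \<ge> u k / 2" by auto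
    have "N * 2 \<le> N * t\<^sup>2" using t N_pos by (intro mult_left_mono) auto
    then have "real (Suc k) \<le> 1 / 4 * (2 * N * t\<^sup>2)"
      using Suc.prems by linarith
    then have "real (Suc k) / (2 * N * t\<^sup>2) \<le> 1 / 4"
      using N_pos t0 by (subst pos_divide_le_eq) auto
    then have a: "real (Suc k) / (2 * N * t\<^sup>2) * u k \<le> 1 / 4 * u k"
      using IH by (intro mult_right_mono) auto
    have b: "real (Suc k) / (2 * N * t\<^sup>2) * u k \<ge> 0"
      using N_pos IH by simp
    have c: "v > 0 \<and> v \<le> 1 \<and> v - q \<le> v \<and> v - q \<ge> v / 2"
      if "q \<le> 1 / 4 * u k" "q \<ge> 0" "v \<le> u k" "v \<ge> u k / 2" for q v
      using that IH by (auto simp: field_simps)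
    show ?case
      unfolding rec by (rule c[OF a b IH(3,4)])
  qed
  then have "(u k)\<^sup>2 \<le> 1" by (simp add: power_le_one)
  then have "(poly (hermite k) t)\<^sup>2 / (t\<^sup>2) ^ k \<le> 1"
    by (simp add: u_def power_divide mult.commute flip: power_mult)
  moreover have "(t\<^sup>2) ^ k > 0" using t0 by simp
  ultimately show ?thesis by (simp add: divide_le_eq)
qed

end

locale scaled_gaussian =
  fixes n :: nat
  assumes n_pos: "n \<ge> 1"
begin

sublocale gaussian_weight "real n"
  using n_pos by unfold_locales simp

text \<open>The kernel is bounded by a partial exponential sum at \<open>2 * n * t^2\<close>, that
  sum by its last term, and the last term by an \<open>n\<close>-th power, so one growth rate serves
  all \<open>n\<close>.\<close>

lemma poly_square_growth:
  assumes f: "degree f \<le> n" and t: "t\<^sup>2 \<ge> 289 / 100"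
  shows "(poly f t)\<^sup>2 * exp (- real n * t\<^sup>2) \<le>
    mean (f\<^sup>2) * (121 / (100 * exp 1)) * (2 * t\<^sup>2 * exp (1 - t\<^sup>2)) ^ n"
proof -
  have "(\<Sum>k\<le>n. (poly (hermite k) t)\<^sup>2 * ((2 * real n) ^ k / fact k)) \<le>
      (\<Sum>k\<le>n. (t\<^sup>2) ^ k * ((2 * real n) ^ k / fact k))"
    using t by (intro sum_mono mult_right_mono hermite_square_le) auto
  also have "\<dots> = (\<Sum>k\<le>n. (2 * real n * t\<^sup>2) ^ k / fact k)"
    by (simp add: power_mult_distrib mult_ac)
  also have "\<dots> \<le> 121 / 100 * ((2 * real n * t\<^sup>2) ^ n / fact n)"
  proof (rule exp_partial_sum_le)
    show "289 / 50 * real n \<le> 2 * real n * t\<^sup>2"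
      using mult_left_mono[OF t, of "2 * real n"] by simp
  qed simp
  also have "(2 * real n * t\<^sup>2) ^ n / fact n = (2 * t\<^sup>2) ^ n * (real n ^ n / fact n)"
    by (simp add: power_mult_distrib)
  also have "121 / 100 * ((2 * t\<^sup>2) ^ n * (real n ^ n / fact n)) \<le> 121 / 100 * ((2 * t\<^sup>2) ^ n * exp (real n - 1))"
    using self_power_le_fact[OF n_pos] by (intro mult_left_mono) (simp_all add: divide_le_eq)
  finally have K: "(\<Sum>k\<le>n. (poly (hermite k) t)\<^sup>2 * ((2 * real n) ^ k / fact k)) \<le>
      121 / 100 * ((2 * t\<^sup>2) ^ n * exp (real n - 1))" .
  have E: "mean (f\<^sup>2) \<ge> 0"
    using mean_square_pos[of f] by (cases "f = 0") auto
  have "(poly f t)\<^sup>2 * exp (- real n * t\<^sup>2) \<le>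
      mean (f\<^sup>2) * (121 / 100 * ((2 * t\<^sup>2) ^ n * exp (real n - 1))) * exp (- real n * t\<^sup>2)"
    using poly_square_le[OF f, of t] mult_left_mono[OF K E]
    by (intro mult_right_mono order_trans[OF poly_square_le[OF f, of t]]) auto
  also have "exp (real n - 1) = exp 1 ^ n / exp 1"
    by (simp add: exp_diff exp_of_nat_mult[symmetric])
  also have "exp (- real n * t\<^sup>2) = exp (- t\<^sup>2) ^ n"
    by (simp flip: exp_of_nat_mult)
  also have "mean (f\<^sup>2) * (121 / 100 * ((2 * t\<^sup>2) ^ n * (exp 1 ^ n / exp 1))) * exp (- t\<^sup>2) ^ n =
      mean (f\<^sup>2) * (121 / (100 * exp 1)) * (2 * t\<^sup>2 * (exp 1 * exp (- t\<^sup>2))) ^ n"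
    by (simp add: power_mult_distrib)
  finally have "(poly f t)\<^sup>2 * exp (- t\<^sup>2) ^ n \<le>
      mean (f\<^sup>2) * (121 / (100 * exp 1)) * (2 * t\<^sup>2 * exp (1 - t\<^sup>2)) ^ n"
    by (simp flip: exp_add)
  moreover have "exp (- real n * t\<^sup>2) = exp (- t\<^sup>2) ^ n"
    by (simp flip: exp_of_nat_mult)
  ultimately show ?thesis by simp
qed

end

section \<open>Elementary bounds for Gaussian tails\<close>

lemma has_bochner_integral_gaussian_tail_majorant:
  fixes b B :: real
  assumes b: "b > 0" and B: "2 * B * b\<^sup>2 > 1"
  shows "has_bochner_integral lborel
    (\<lambda>t. indicator {b..} t * ((2 * B * t\<^sup>2 - 1) * exp (- B * t\<^sup>2))) (b * exp (- B * b\<^sup>2))"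
proof (rule has_bochner_integral_nn_integral)
  have B0: "B > 0"
  proof (rule ccontr)
    assume "\<not> B > 0"
    then have "B * b\<^sup>2 \<le> 0" by (simp add: mult_nonpos_nonneg)
    then show False using B by (simp add: mult.assoc)
  qed
  have ge: "2 * B * t\<^sup>2 - 1 \<ge> 0" if "t \<ge> b" for t
  proof -
    have "B * b\<^sup>2 \<le> B * t\<^sup>2" using that b B0 by (intro mult_left_mono power_mono) auto
    then show ?thesis using B by linarith
  qed
  show "AE t in lborel. 0 \<le> indicator {b..} t * ((2 * B * t\<^sup>2 - 1) * exp (- B * t\<^sup>2))"
    using ge by (auto simp: indicator_def)
  \<comment> \<open>Unlike \<open>t^2 * exp (- B * t^2)\<close>, this integrand has an elementary
    antiderivative, namely \<open>- (t * exp (- B * t^2))\<close>.\<close>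
  have "((\<lambda>t. - (t * exp (- B * t\<^sup>2))) \<longlongrightarrow> 0) at_top"
    using B0 by real_asymp
  then have "(\<integral>\<^sup>+t. ennreal ((2 * B * t\<^sup>2 - 1) * exp (- B * t\<^sup>2)) * indicator {b..} t \<partial>lborel) =
      ennreal (0 - - (b * exp (- B * b\<^sup>2)))"
    using ge by (intro nn_integral_FTC_atLeast)
      (auto intro!: derivative_eq_intros simp: algebra_simps power2_eq_square)
  then show "(\<integral>\<^sup>+t. ennreal (indicator {b..} t * ((2 * B * t\<^sup>2 - 1) * exp (- B * t\<^sup>2))) \<partial>lborel) =
      ennreal (b * exp (- B * b\<^sup>2))"
    by (subst nn_integral_cong[where v = "\<lambda>t. ennreal ((2 * B * t\<^sup>2 - 1) * exp (- B * t\<^sup>2)) * indicator {b..} t"])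
      (auto simp: indicator_def)
qed (use b in auto)

text \<open>The quotient \<open>t^2 / (2 * B * t^2 - 1)\<close> decreases in \<open>t^2\<close>, so
  its value at \<open>b\<close> compares the integrand with the explicit majorant; evenness doubles
  the half-line integral.\<close>

lemma gaussian_tail_integral:
  fixes b B :: real
  assumes b: "b > 0" and B: "2 * B * b\<^sup>2 > 1"
  shows "integrable lborel (\<lambda>t. indicator {t. b \<le> \<bar>t\<bar>} t * (t\<^sup>2 * exp (- B * t\<^sup>2)))" (is "integrable _ ?f")
    and "(LINT t|lborel. indicator {t. b \<le> \<bar>t\<bar>} t * (t\<^sup>2 * exp (- B * t\<^sup>2))) \<le>
      2 * b ^ 3 * exp (- B * b\<^sup>2) / (2 * B * b\<^sup>2 - 1)"
proof -
  let ?c = "2 * B * b\<^sup>2 - 1"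
  let ?g = "\<lambda>t. indicator {t. b \<le> \<bar>t\<bar>} t * ((2 * B * t\<^sup>2 - 1) * exp (- B * t\<^sup>2))"
  have "has_bochner_integral lborel ?g (2 *\<^sub>R (b * exp (- B * b\<^sup>2)))"
  proof (rule has_bochner_integral_even_function)
    have "(\<lambda>t. indicator {0..} t *\<^sub>R ?g t) =
        (\<lambda>t. indicator {b..} t * ((2 * B * t\<^sup>2 - 1) * exp (- B * t\<^sup>2)))"
      using b by (auto simp: fun_eq_iff indicator_def)
    then show "has_bochner_integral lborel (\<lambda>t. indicator {0..} t *\<^sub>R ?g t) (b * exp (- B * b\<^sup>2))"
      using has_bochner_integral_gaussian_tail_majorant[OF assms] by simp
  qed (simp add: indicator_def)
  then have "has_bochner_integral lborel (\<lambda>t. b\<^sup>2 / ?c * ?g t) (b\<^sup>2 / ?c * (2 *\<^sub>R (b * exp (- B * b\<^sup>2))))"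
    by (rule has_bochner_integral_mult_right)
  then have g: "integrable lborel (\<lambda>t. b\<^sup>2 / ?c * ?g t)"
      "(LINT t|lborel. b\<^sup>2 / ?c * ?g t) = 2 * b ^ 3 * exp (- B * b\<^sup>2) / ?c"
    by (auto simp: has_bochner_integral_iff power2_eq_square power3_eq_cube mult_ac)
  have le: "?f t \<le> b\<^sup>2 / ?c * ?g t" for t
  proof (cases "b \<le> \<bar>t\<bar>")
    case True
    then have "b\<^sup>2 \<le> t\<^sup>2" using b by (simp add: abs_le_square_iff[symmetric])
    then have "t\<^sup>2 \<le> b\<^sup>2 / ?c * (2 * B * t\<^sup>2 - 1)"
      using B by (simp add: field_simps)
    then have "t\<^sup>2 * exp (- B * t\<^sup>2) \<le> b\<^sup>2 / ?c * (2 * B * t\<^sup>2 - 1) * exp (- B * t\<^sup>2)"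
      by (rule mult_right_mono) simp
    then show ?thesis using True by simp
  qed simp
  show int: "integrable lborel ?f"
  proof (rule Bochner_Integration.integrable_bound[OF g(1)])
    show "AE t in lborel. norm (?f t) \<le> norm (b\<^sup>2 / ?c * ?g t)"
    proof (rule AE_I2)
      fix t :: real
      have "norm (?f t) = ?f t" by simp
      also have "\<dots> \<le> norm (b\<^sup>2 / ?c * ?g t)"
        by (rule order_trans[OF le]) (simp only: real_norm_def abs_ge_self)
      finally show "norm (?f t) \<le> norm (b\<^sup>2 / ?c * ?g t)" .
    qed
  qed measurable
  show "integral\<^sup>L lborel ?f \<le> 2 * b ^ 3 * exp (- B * b\<^sup>2) / ?c"
    unfolding g(2)[symmetric] by (intro integral_mono int g(1) le)
qed

subsection \<open>Positivity of Gaussian means\<close>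

text \<open>This absorbs the normalising factor \<open>sqrt n\<close> of the weight and makes the
  later bounds uniform in \<open>n\<close>.\<close>

lemma sqrt_mult_power_le:
  fixes x :: real
  assumes x: "0 \<le> x" "x \<le> 7 / 8" and n: "n \<ge> 1"
  shows "sqrt (real n) * x ^ n \<le> 27 / 20 * x"
proof -
  \<comment> \<open>Here \<open>49 / 64 = (7 / 8)^2\<close>. The sequence peaks at
    \<open>m = 3\<close> with a value just below \<open>9 / 5\<close>, and
    \<open>9 / 5 <= (27 / 20)^2\<close>.\<close>
  have "real (m + 1) * (49 / 64) ^ m \<le> 9 / 5" for m
  proof (cases "m < 3")
    case True
    then have "m = 0 \<or> m = 1 \<or> m = 2" by linarith
    then show ?thesis by (auto simp: power2_eq_square)
  next
    case False
    then have "3 \<le> m" by simp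
    then show ?thesis
    proof (induction m rule: dec_induct)
      case (step m)
      have "real (Suc m + 1) * (49 / 64) ^ Suc m = (real (m + 2) * (49 / 64)) * (49 / 64) ^ m"
        by simp
      also have "\<dots> \<le> real (m + 1) * (49 / 64) ^ m"
        using step by (intro mult_right_mono) auto
      finally show ?case using step by linarith
    qed (simp add: eval_nat_numeral)
  qed
  from this[of "n - 1"] have le: "real n * (49 / 64) ^ (n - 1) \<le> 9 / 5"
    using n by simp
  have "(sqrt (real n) * x ^ (n - 1))\<^sup>2 = real n * (x\<^sup>2) ^ (n - 1)"
    by (simp add: power_mult_distrib mult.commute flip: power_mult)
  also have "\<dots> \<le> real n * ((7 / 8)\<^sup>2) ^ (n - 1)"
    using x by (intro mult_left_mono power_mono) auto
  also have "\<dots> \<le> (27 / 20)\<^sup>2"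
    using le by (simp add: power2_eq_square)
  finally have "sqrt (real n) * x ^ (n - 1) \<le> 27 / 20"
    by (rule power2_le_imp_le) simp
  then have "sqrt (real n) * x ^ (n - 1) * x \<le> 27 / 20 * x"
    using x(1) by (rule mult_right_mono)
  then show ?thesis
    using n by (cases n) (simp_all add: mult_ac)
qed

section \<open>Numerical bounds for the exponential function and the growth rates\<close>

lemma exp_partial_sum_lower:
  fixes x :: real
  assumes "x \<ge> 0"
  shows "(\<Sum>k<m. x ^ k / fact k) \<le> exp x"
  using sum_le_suminf[OF summable_exp_generic[of x], of "{..<m}"] assms
  by (simp add: exp_def divide_inverse mult.commute)

text \<open>The arguments are \<open>(17 / 10)^2 - 1\<close> and \<open>1 + 4 / 3\<close>, from the
  endpoints \<open>17 / 10\<close> and \<open>2\<close>. The bound \<open>3303 / 500\<close> barely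
  exceeds \<open>8 / 7 * 289 / 50\<close>, as the rate \<open>7 / 8\<close> demands. Cubing Taylor
  sums at a third of the argument keeps the sums short.\<close>

lemma exp_numeric_bounds:
  "exp (189 / 100 :: real) \<ge> 3303 / 500"
  "exp (7 / 3 :: real) \<ge> 10"
  "exp (1 :: real) \<ge> 27 / 10"
proof -
  have "(9383 / 5000) ^ 3 \<le> exp (63 / 100 :: real) ^ 3"
    using exp_partial_sum_lower[of "63 / 100" 5]
    by (intro power_mono) (simp_all add: lessThan_nat_numeral fact_numeral eval_nat_numeral)
  then show "exp (189 / 100 :: real) \<ge> 3303 / 500"
    by (simp add: eval_nat_numeral mult_exp_exp)
  have "(2158 / 1000) ^ 3 \<le> exp (7 / 9 :: real) ^ 3"
    using exp_partial_sum_lower[of "7 / 9" 4]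
    by (intro power_mono) (simp_all add: lessThan_nat_numeral fact_numeral eval_nat_numeral)
  then show "exp (7 / 3 :: real) \<ge> 10"
    by (simp add: eval_nat_numeral mult_exp_exp)
  show "exp (1 :: real) \<ge> 27 / 10"
    using exp_partial_sum_lower[of 1 6] by (simp add: lessThan_nat_numeral fact_numeral)
qed

text \<open>A weakening of \<open>x <= exp (x / e)\<close>, the tangent to \<open>exp\<close> at 1,
  using \<open>1 / e < 2 / 5\<close>.\<close>

lemma le_exp_two_fifths: "x \<le> exp (2 / 5 * x)" for x :: real
proof -
  have "2 / 5 * x \<le> exp (2 / 5 * x - 1)"
    using exp_ge_add_one_self[of "2 / 5 * x - 1"] by simp
  also have "\<dots> = exp (2 / 5 * x) / exp 1" by (simp add: exp_diff)
  also have "\<dots> \<le> exp (2 / 5 * x) / (5 / 2)"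
    using exp_numeric_bounds(3) by (intro divide_left_mono) auto
  finally show ?thesis by simp
qed

lemma two_mult_exp_le_inner:
  fixes y :: real
  assumes "y \<ge> 289 / 100"
  shows "2 * y * exp (1 - y) \<le> 7 / 8"
proof -
  have "289 / 100 * (1 + (y - 289 / 100)) \<le> 289 / 100 * exp (y - 289 / 100)"
    by (intro mult_left_mono exp_ge_add_one_self) auto
  moreover have "y \<le> 289 / 100 * (1 + (y - 289 / 100))" using assms by simp
  ultimately have "y * exp (1 - y) \<le> 289 / 100 * exp (y - 289 / 100) * exp (1 - y)"
    by (intro mult_right_mono) auto
  also have "\<dots> = 289 / 100 * exp (- (189 / 100))"
    by (simp add: mult_exp_exp mult.assoc)
  also have "\<dots> = 289 / 100 / exp (189 / 100)"
    by (simp only: exp_minus divide_inverse)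
  also have "\<dots> \<le> 289 / 100 / (3303 / 500)"
    using exp_numeric_bounds(1) by (intro divide_left_mono) auto
  finally show ?thesis by simp
qed

text \<open>With \<open>y = t^2\<close>, the exponent is the Gaussian one \<open>1 - y\<close> plus
  the allowed growth \<open>2 / 3 * y - 2\<close>.\<close>

lemma two_mult_exp_le_outer:
  fixes y :: real
  assumes "y \<ge> 4"
  shows "2 * y * exp (- 1 - y / 3) \<le> 7 / 8"
proof -
  have "4 * (1 + (y - 4) / 3) \<le> 4 * exp ((y - 4) / 3)"
    by (intro mult_left_mono exp_ge_add_one_self) auto
  moreover have "y \<le> 4 * (1 + (y - 4) / 3)" using assms by (simp add: field_simps)
  ultimately have "y * exp (- 1 - y / 3) \<le> 4 * exp ((y - 4) / 3) * exp (- 1 - y / 3)"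
    by (intro mult_right_mono) auto
  also have "\<dots> = 4 * exp (- (7 / 3))"
    by (simp add: mult_exp_exp mult.assoc diff_divide_distrib)
  also have "\<dots> = 4 / exp (7 / 3)"
    by (simp only: exp_minus divide_inverse)
  also have "\<dots> \<le> 4 / 10"
    using exp_numeric_bounds(2) by (intro divide_left_mono) auto
  finally show ?thesis by simp
qed

context scaled_gaussian
begin

text \<open>Up to a constant factor, the first summand dominates the mass of \<open>A^2\<close>
  beyond \<open>17 / 10\<close> and the second the possible negative part of \<open>A^2 * F\<close>
  beyond \<open>2\<close>. The exponents are written to match the tail integral with
  \<open>B = 1\<close> and \<open>B = 1 / 3\<close>.\<close>

definition tail :: "real \<Rightarrow> real" where
  "tail t = indicator {t. 17 / 10 \<le> \<bar>t\<bar>} t * (t\<^sup>2 * exp (- 1 * t\<^sup>2)) +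
    exp (- 2) * (indicator {t. 2 \<le> \<bar>t\<bar>} t * (t\<^sup>2 * exp (- (1 / 3) * t\<^sup>2)))"

lemma integrable_tail: "integrable lborel tail"
  and integral_tail_le: "integral\<^sup>L lborel tail \<le> 1 / 2"
proof -
  note inner = gaussian_tail_integral[of "17 / 10" 1]
  note outer = gaussian_tail_integral[of 2 "1 / 3"]
  show "integrable lborel tail"
    unfolding tail_def[abs_def] using inner(1) outer(1)
    by (intro Bochner_Integration.integrable_add integrable_mult_right) (simp_all add: power2_eq_square)
  have "integral\<^sup>L lborel tail =
    (LINT t|lborel. indicator {t. 17 / 10 \<le> \<bar>t\<bar>} t * (t\<^sup>2 * exp (- 1 * t\<^sup>2))) +
    exp (- 2) * (LINT t|lborel. indicator {t. 2 \<le> \<bar>t\<bar>} t * (t\<^sup>2 * exp (- (1 / 3) * t\<^sup>2)))"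
    unfolding tail_def[abs_def] using inner(1) outer(1)
    by (subst Bochner_Integration.integral_add) (simp_all add: power2_eq_square)
  also have "\<dots> \<le> 2 * (17 / 10) ^ 3 * exp (- 1 * (17 / 10)\<^sup>2) / (2 * 1 * (17 / 10)\<^sup>2 - 1) +
      exp (- 2) * (2 * 2 ^ 3 * exp (- (1 / 3) * 2\<^sup>2) / (2 * (1 / 3) * 2\<^sup>2 - 1))"
    using inner(2) outer(2) by (intro add_mono mult_left_mono) (simp_all add: power2_eq_square)
  also have "\<dots> = 4913 / 2390 * exp (- (289 / 100)) + 48 / 5 * (exp (- 2) * exp (- (4 / 3)))"
    by (simp add: power2_eq_square power3_eq_cube)
  \<comment> \<open>Both exponentials are split so that only the numerically bounded values of
    \<open>exp\<close> occur.\<close>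
  also have "exp (- 2) * exp (- (4 / 3)) = 1 / (exp (7 / 3) * exp (1 :: real))"
    unfolding mult_exp_exp inverse_eq_divide[symmetric] exp_minus[symmetric] by simp
  also have "exp (- (289 / 100)) = 1 / (exp (189 / 100) * exp (1 :: real))"
    unfolding mult_exp_exp inverse_eq_divide[symmetric] exp_minus[symmetric] by simp
  also have "4913 / 2390 * (1 / (exp (189 / 100) * exp (1 :: real))) + 48 / 5 * (1 / (exp (7 / 3) * exp (1 :: real))) \<le>
      4913 / 2390 * (1 / (6 * (27 / 10))) + 48 / 5 * (1 / (10 * (27 / 10)))"
    using exp_numeric_bounds
    by (intro add_mono mult_left_mono divide_left_mono mult_mono) auto
  also have "\<dots> \<le> 1 / 2" by simp
  finally show "integral\<^sup>L lborel tail \<le> 1 / 2" .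
qed

text \<open>
  The exponent \<open>2/3 t^2 - 2\<close> is a quadratic majorant of the growth rate \<open>3 ln ((t - 2) / (2 - 17/10))\<close>
  of a polynomial of degree \<open>3 n\<close> with zeros \<open>>= 2\<close> that is normalised at \<open>17/10\<close>.
\<close>

lemma mean_square_mult_pos:
  assumes A: "A \<noteq> 0" "degree A \<le> n"
    and F1: "\<And>t. \<bar>t\<bar> \<le> 17 / 10 \<Longrightarrow> poly F t \<ge> 1"
    and F2: "\<And>t. \<bar>t\<bar> \<le> 2 \<Longrightarrow> poly F t \<ge> 0"
    and F3: "\<And>t. \<bar>t\<bar> \<ge> 2 \<Longrightarrow> poly F t \<ge> - exp (real n * (2 / 3 * t\<^sup>2 - 2))"
  shows "mean (A\<^sup>2 * F) > 0"
proof -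
  define m where "m = mean (A\<^sup>2)"
  \<comment> \<open>\<open>3267 / 1000 = 2 * 27 / 20 * 121 / 100\<close> collects the constants of
    the growth estimates.\<close>
  define K where "K = m * (3267 / 1000) / sqrt pi"
  have m: "m > 0" using mean_square_pos[OF A(1)] by (simp add: m_def)
  then have K: "K > 0" by (simp add: K_def)
  define S where "S t = (poly A t)\<^sup>2 * weight t" for t
  have S0: "S t \<ge> 0" for t using weight_pos[of t] by (simp add: S_def)
  have S_le: "S t \<le> m / sqrt pi * (121 / (100 * exp 1)) * (sqrt (real n) * (2 * t\<^sup>2 * exp (1 - t\<^sup>2)) ^ n)"
    if "\<bar>t\<bar> \<ge> 17 / 10" for t
  proof -
    have "\<bar>17 / 10 :: real\<bar> \<le> \<bar>t\<bar>" using that by simp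
    then have "t\<^sup>2 \<ge> 289 / 100" by (subst (asm) abs_le_square_iff) (simp add: power2_eq_square)
    from mult_left_mono[OF poly_square_growth[OF A(2) this], of "sqrt (real n / pi)"]
    show ?thesis by (simp add: S_def weight_def m_def real_sqrt_divide mult_ac)
  qed
  have inner: "S t \<le> K * (t\<^sup>2 * exp (- 1 * t\<^sup>2))" if t: "\<bar>t\<bar> \<ge> 17 / 10" for t
  proof -
    have "\<bar>17 / 10 :: real\<bar> \<le> \<bar>t\<bar>" using that by simp
    then have "t\<^sup>2 \<ge> 289 / 100" by (subst (asm) abs_le_square_iff) (simp add: power2_eq_square)
    then have "sqrt (real n) * (2 * t\<^sup>2 * exp (1 - t\<^sup>2)) ^ n \<le> 27 / 20 * (2 * t\<^sup>2 * exp (1 - t\<^sup>2))"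
      using two_mult_exp_le_inner n_pos by (intro sqrt_mult_power_le) auto
    from mult_left_mono[OF this, of "m / sqrt pi * (121 / (100 * exp 1))"] m
    have "S t \<le> m / sqrt pi * (121 / (100 * exp 1)) * (27 / 20 * (2 * t\<^sup>2 * exp (1 - t\<^sup>2)))"
      by (intro order_trans[OF S_le[OF t]]) auto
    also have "exp (1 - t\<^sup>2) = exp 1 * exp (- 1 * t\<^sup>2)"
      by (simp add: mult_exp_exp)
    also have "m / sqrt pi * (121 / (100 * exp 1)) * (27 / 20 * (2 * t\<^sup>2 * (exp 1 * exp (- 1 * t\<^sup>2)))) =
        K * (t\<^sup>2 * exp (- 1 * t\<^sup>2))"
      by (simp add: K_def)
    finally show ?thesis .
  qed
  have outer: "S t * exp (real n * (2 / 3 * t\<^sup>2 - 2)) \<le> K * (exp (- 2) * (t\<^sup>2 * exp (- (1 / 3) * t\<^sup>2)))"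
    if t: "\<bar>t\<bar> \<ge> 2" for t
  proof -
    have "\<bar>2 :: real\<bar> \<le> \<bar>t\<bar>" using that by simp
    then have t2: "t\<^sup>2 \<ge> 4" by (subst (asm) abs_le_square_iff) simp
    have "exp (1 - t\<^sup>2) * exp (2 / 3 * t\<^sup>2 - 2) = exp (- 1 - t\<^sup>2 / 3)"
      by (simp add: mult_exp_exp field_simps)
    then have eq: "(2 * t\<^sup>2 * exp (1 - t\<^sup>2)) ^ n * exp (real n * (2 / 3 * t\<^sup>2 - 2)) =
        (2 * t\<^sup>2 * exp (- 1 - t\<^sup>2 / 3)) ^ n"
      by (simp only: exp_of_nat_mult flip: power_mult_distrib mult.assoc)
        (simp only: mult.assoc)
    have "sqrt (real n) * (2 * t\<^sup>2 * exp (- 1 - t\<^sup>2 / 3)) ^ n \<le> 27 / 20 * (2 * t\<^sup>2 * exp (- 1 - t\<^sup>2 / 3))"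
      using two_mult_exp_le_outer[OF t2] n_pos by (intro sqrt_mult_power_le) auto
    from mult_left_mono[OF this, of "m / sqrt pi * (121 / (100 * exp 1))"] m
    have "m / sqrt pi * (121 / (100 * exp 1)) * (sqrt (real n) * (2 * t\<^sup>2 * exp (1 - t\<^sup>2)) ^ n)
        * exp (real n * (2 / 3 * t\<^sup>2 - 2)) \<le>
        m / sqrt pi * (121 / (100 * exp 1)) * (27 / 20 * (2 * t\<^sup>2 * exp (- 1 - t\<^sup>2 / 3)))"
      unfolding eq[symmetric] using m by (simp add: mult.assoc)
    moreover have "S t * exp (real n * (2 / 3 * t\<^sup>2 - 2)) \<le>
        m / sqrt pi * (121 / (100 * exp 1)) * (sqrt (real n) * (2 * t\<^sup>2 * exp (1 - t\<^sup>2)) ^ n)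
        * exp (real n * (2 / 3 * t\<^sup>2 - 2))"
      using t by (intro mult_right_mono S_le) auto
    ultimately have "S t * exp (real n * (2 / 3 * t\<^sup>2 - 2)) \<le>
        m / sqrt pi * (121 / (100 * exp 1)) * (27 / 20 * (2 * t\<^sup>2 * exp (- 1 - t\<^sup>2 / 3)))"
      by (rule order_trans[rotated])
    also have "exp (- 1 - t\<^sup>2 / 3) = exp 1 * (exp (- 2) * exp (- (1 / 3) * t\<^sup>2))"
      by (simp add: mult_exp_exp)
    also have "m / sqrt pi * (121 / (100 * exp 1)) * (27 / 20 * (2 * t\<^sup>2 * (exp 1 * (exp (- 2) * exp (- (1 / 3) * t\<^sup>2))))) =
        K * (exp (- 2) * (t\<^sup>2 * exp (- (1 / 3) * t\<^sup>2)))"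
      by (simp add: K_def)
    finally show ?thesis .
  qed
  \<comment> \<open>For \<open>17 / 10 <= |t| < 2\<close> the left side is at most 0 by
    \<open>inner\<close>; for \<open>|t| >= 2\<close> it also pays for the negative part by
    \<open>outer\<close>.\<close>
  have pointwise: "S t - K * tail t \<le> poly (A\<^sup>2 * F) t * weight t" for t
  proof -
    have eq: "poly (A\<^sup>2 * F) t * weight t = S t * poly F t" by (simp add: S_def)
    consider "\<bar>t\<bar> < 17 / 10" | "17 / 10 \<le> \<bar>t\<bar>" "\<bar>t\<bar> < 2" | "2 \<le> \<bar>t\<bar>" by linarith
    then show ?thesis
    proof cases
      case 1
      have "S t * 1 \<le> S t * poly F t" using F1[of t] 1 S0[of t] by (intro mult_left_mono) auto
      then show ?thesis unfolding eq using 1 by (simp add: tail_def)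
    next
      case 2
      have "0 \<le> S t * poly F t" using F2[of t] 2 S0[of t] by (intro mult_nonneg_nonneg) auto
      then show ?thesis unfolding eq using 2 inner[of t] by (simp add: tail_def)
    next
      case 3
      have "S t * - exp (real n * (2 / 3 * t\<^sup>2 - 2)) \<le> S t * poly F t"
        using F3[of t] 3 S0[of t] by (intro mult_left_mono) auto
      then show ?thesis unfolding eq using 3 inner[of t] outer[of t] by (simp add: tail_def distrib_left)
    qed
  qed
  have S_int: "integrable lborel S"
    using integrable_poly[of "A\<^sup>2"] by (simp add: S_def[abs_def])
  \<comment> \<open>This amounts to \<open>sqrt pi > 1.6335\<close>, which \<open>pi > 3\<close>
    already gives.\<close>
  have "0 < m - K * (1 / 2)"
  proof -
    have "sqrt 3 \<le> sqrt pi" using pi_gt3 by simp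
    moreover have "sqrt 3 \<ge> (1.7 :: real)" by (rule real_le_rsqrt) (simp add: power2_eq_square)
    ultimately have "sqrt pi \<ge> 1.7" by linarith
    then have "3267 / 1000 / sqrt pi < 2"
      by (subst pos_divide_less_eq) auto
    from mult_strict_left_mono[OF this m] show ?thesis by (simp add: K_def)
  qed
  also have "m - K * (1 / 2) \<le> m - K * integral\<^sup>L lborel tail"
    using integral_tail_le K by simp
  also have "\<dots> = (LINT t|lborel. S t - K * tail t)"
    using S_int integrable_tail by (subst Bochner_Integration.integral_diff) (simp_all add: m_def mean_def S_def[abs_def])
  also have "\<dots> \<le> mean (A\<^sup>2 * F)"
    unfolding mean_def using S_int integrable_tail
    by (intro integral_mono integrable_poly pointwise) auto
  finally show ?thesis .
qed

text \<open>The product is normalised at \<open>17 / 10\<close>: the factors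
  \<open>(z j - t) / (z j - 17 / 10)\<close> are at least 1 to the left of that point and
  nonnegative up to \<open>2\<close>. Reversing each difference produces the sign.\<close>

lemma mean_square_mult_prod_right:
  assumes A: "A \<noteq> 0" "degree A \<le> n"
    and J: "finite J" "card J \<le> 3 * n" and z: "\<And>j. j \<in> J \<Longrightarrow> z j \<ge> 2"
  shows "(- 1) ^ card J * mean (A\<^sup>2 * (\<Prod>j\<in>J. [:- z j, 1:])) > 0"
proof -
  define R where "R = (\<Prod>j\<in>J. [:- z j, 1:])"
  define r where "r = (\<Prod>j\<in>J. z j - 17 / 10)"
  have r: "r > 0" unfolding r_def using z by (intro prod_pos) force
  have poly_R: "(- 1) ^ card J / r * poly R t = (\<Prod>j\<in>J. (z j - t) / (z j - 17 / 10))" for t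
  proof -
    have "(\<Prod>j\<in>J. z j - t) = (\<Prod>j\<in>J. - 1 * (t - z j))"
      by simp
    also have "\<dots> = (- 1) ^ card J * (\<Prod>j\<in>J. t - z j)"
      by (simp only: prod.distrib prod_constant)
    finally show ?thesis
      by (simp add: r_def R_def poly_prod prod_dividef)
  qed
  have "mean (A\<^sup>2 * smult ((- 1) ^ card J / r) R) > 0"
  proof (rule mean_square_mult_pos[OF A])
    fix t :: real
    show "poly (smult ((- 1) ^ card J / r) R) t \<ge> 1" if "\<bar>t\<bar> \<le> 17 / 10"
      unfolding poly_smult poly_R using z that by (intro prod_ge_1) (force simp: field_simps)
    show nonneg: "poly (smult ((- 1) ^ card J / r) R) t \<ge> 0" if "\<bar>t\<bar> \<le> 2"
      unfolding poly_smult poly_R using z that by (intro prod_nonneg) (force simp: field_simps)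
    show "poly (smult ((- 1) ^ card J / r) R) t \<ge> - exp (real n * (2 / 3 * t\<^sup>2 - 2))" if "\<bar>t\<bar> \<ge> 2"
    proof (cases "t < 0")
      case True
      then have "poly (smult ((- 1) ^ card J / r) R) t \<ge> 0"
        unfolding poly_smult poly_R using z by (intro prod_nonneg) (force simp: field_simps)
      then show ?thesis by (rule order_trans[rotated]) simp
    next
      case False
      then have t: "t \<ge> 2" using that by simp
      define g where "g = 2 / 3 * t\<^sup>2 - 2"
      have "2 * 2 \<le> t * t" using t by (intro mult_mono) auto
      then have g: "g \<ge> 0" by (simp add: g_def power2_eq_square)
      have factor: "\<bar>(z j - t) / (z j - 17 / 10)\<bar> \<le> exp (g / 3)" if "j \<in> J" for j
      proof (cases "t \<le> z j")
        case True
        then have "\<bar>(z j - t) / (z j - 17 / 10)\<bar> \<le> 1" using t z[OF that] by simp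
        then show ?thesis by (rule order_trans) (use g in simp)
      next
        case False
        have "0 \<le> (z j - 2) * (t - 17 / 10)"
          using t z[OF that] by (intro mult_nonneg_nonneg) auto
        \<comment> \<open>The extreme case is \<open>z j = 2\<close>, with quotient
          \<open>(t - 2) / (3 / 10)\<close>.\<close>
        moreover have "10 / 3 * (t - 2) * (z j - 17 / 10) - (t - z j) = 10 / 3 * ((z j - 2) * (t - 17 / 10))"
          by (simp add: field_simps)
        ultimately have "t - z j \<le> 10 / 3 * (t - 2) * (z j - 17 / 10)" by linarith
        then have "(t - z j) / (z j - 17 / 10) \<le> 10 / 3 * (t - 2)"
          using z[OF that] by (subst pos_divide_le_eq) auto
        then have "\<bar>(z j - t) / (z j - 17 / 10)\<bar> \<le> 10 / 3 * (t - 2)"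
          unfolding abs_divide using False z[OF that] by simp
        also have "\<dots> \<le> exp (2 / 5 * (10 / 3 * (t - 2)))" by (rule le_exp_two_fifths)
        \<comment> \<open>The majorant is the parabola tangent to \<open>4 * (t - 2)\<close> at
          \<open>t = 3\<close>, whence the square of \<open>t - 3\<close>.\<close>
        also have "\<dots> \<le> exp (g / 3)"
          using zero_le_power2[of "t - 3"] by (simp add: g_def power2_eq_square field_simps)
        finally show ?thesis .
      qed
      have "\<bar>poly (smult ((- 1) ^ card J / r) R) t\<bar> = (\<Prod>j\<in>J. \<bar>(z j - t) / (z j - 17 / 10)\<bar>)"
        unfolding poly_smult poly_R by (rule abs_prod)
      also have "\<dots> \<le> (\<Prod>j\<in>J. exp (g / 3))"
        using factor by (intro prod_mono) auto
      also have "\<dots> = exp (real (card J) * (g / 3))"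
        by (simp flip: exp_of_nat_mult)
      also have "\<dots> \<le> exp (real n * g)"
      proof -
        have "real (card J) * (g / 3) \<le> real (3 * n) * (g / 3)"
          using J g by (intro mult_right_mono of_nat_mono) auto
        then show ?thesis by simp
      qed
      finally have "- exp (real n * g) \<le> poly (smult ((- 1) ^ card J / r) R) t"
        by (simp only: abs_le_iff minus_le_iff)
      then show ?thesis by (simp only: g_def)
    qed
  qed
  then show ?thesis
    using r by (simp add: mean_smult R_def zero_less_mult_iff zero_less_divide_iff)
qed

text \<open>Symmetry turns \<open>R^2\<close> into a product over \<open>t^2 - z^2\<close>, so sizes
  are estimated factorwise in \<open>t^2\<close>. The sign of \<open>R\<close> at
  \<open>17 / 10\<close> is not tracked; hence only nonvanishing is claimed.\<close>

lemma mean_square_mult_prod_symmetric: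
  assumes A: "A \<noteq> 0" "degree A \<le> n"
    and Z: "finite Z" "card Z \<le> 3 * n" "uminus ` Z = Z" and z: "\<And>z. z \<in> Z \<Longrightarrow> \<bar>z\<bar> \<ge> 2"
  shows "mean (A\<^sup>2 * (\<Prod>z\<in>Z. [:- z, 1:])) \<noteq> 0"
proof -
  define R where "R = (\<Prod>z\<in>Z. [:- z, 1:])"
  define s where "s = (17 / 10 :: real)"
  have poly_R: "poly R t = (\<Prod>z\<in>Z. t - z)" for t
    by (simp add: R_def poly_prod)
  have z2: "z\<^sup>2 \<ge> 4" if "z \<in> Z" for z
  proof -
    have "\<bar>2 :: real\<bar> \<le> \<bar>z\<bar>" using z[OF that] by simp
    then show ?thesis by (subst (asm) abs_le_square_iff) simp
  qed
  have s2: "s\<^sup>2 = 289 / 100" by (simp add: s_def power2_eq_square)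
  have R_s: "poly R s \<noteq> 0"
    unfolding poly_R using Z by (auto simp: s_def dest!: z)
  have square: "(poly R t)\<^sup>2 = (\<Prod>z\<in>Z. t\<^sup>2 - z\<^sup>2)" for t
  proof -
    have "poly R t = (\<Prod>z\<in>uminus ` Z. t - z)" using Z by (simp add: poly_R)
    also have "\<dots> = (\<Prod>z\<in>Z. t + z)" by (subst prod.reindex) auto
    finally have "(poly R t)\<^sup>2 = (\<Prod>z\<in>Z. t - z) * (\<Prod>z\<in>Z. t + z)"
      by (simp add: power2_eq_square poly_R)
    then show ?thesis by (simp add: prod.distrib[symmetric] power2_eq_square algebra_simps)
  qed
  define F where "F = smult (1 / poly R s) R"
  have F_square: "(poly F t)\<^sup>2 = (\<Prod>z\<in>Z. \<bar>t\<^sup>2 - z\<^sup>2\<bar> / (z\<^sup>2 - s\<^sup>2))" for t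
  proof -
    have "(poly F t)\<^sup>2 = \<bar>(poly R t)\<^sup>2 / (poly R s)\<^sup>2\<bar>"
      by (simp add: F_def power_divide)
    also have "\<dots> = (\<Prod>z\<in>Z. \<bar>t\<^sup>2 - z\<^sup>2\<bar>) / (\<Prod>z\<in>Z. \<bar>s\<^sup>2 - z\<^sup>2\<bar>)"
      by (simp only: square abs_divide abs_prod)
    also have "\<dots> = (\<Prod>z\<in>Z. \<bar>t\<^sup>2 - z\<^sup>2\<bar> / (z\<^sup>2 - s\<^sup>2))"
      unfolding prod_dividef using z2 by (intro arg_cong2[of _ _ _ _ "(/)"] prod.cong) (force simp: s2)+
    finally show ?thesis .
  qed
  have F_nonneg: "poly F t \<ge> 0" if "\<bar>t\<bar> \<le> 2" for t
  proof -
    have "poly F t = (\<Prod>z\<in>Z. (t - z) / (s - z))"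
      by (simp add: F_def poly_R prod_dividef)
    also have "\<dots> \<ge> 0"
    proof (intro prod_nonneg)
      fix y assume "y \<in> Z"
      then show "0 \<le> (t - y) / (s - y)"
        using z[of y] that by (auto simp: s_def zero_le_divide_iff abs_if split: if_splits)
    qed
    finally show ?thesis .
  qed
  have "mean (A\<^sup>2 * F) > 0"
  proof (rule mean_square_mult_pos[OF A])
    fix t :: real
    show "poly F t \<ge> 0" if "\<bar>t\<bar> \<le> 2" using that by (rule F_nonneg)
    show "poly F t \<ge> 1" if t: "\<bar>t\<bar> \<le> 17 / 10"
    proof -
      have "\<bar>t\<bar> \<le> \<bar>s\<bar>" using t by (simp add: s_def)
      then have "t\<^sup>2 \<le> s\<^sup>2" by (simp add: abs_le_square_iff)
      then have "1 \<le> \<bar>t\<^sup>2 - y\<^sup>2\<bar> / (y\<^sup>2 - s\<^sup>2)" if "y \<in> Z" for y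
        using z2[OF that] by (simp add: s2)
      then have "1 \<le> (poly F t)\<^sup>2" unfolding F_square by (intro prod_ge_1)
      then have "1\<^sup>2 \<le> (poly F t)\<^sup>2" by simp
      \<comment> \<open>The square determines only the size of \<open>F\<close>; its sign comes from
        \<open>F_nonneg\<close>.\<close>
      then show ?thesis by (rule power2_le_imp_le) (use t in \<open>auto intro: F_nonneg\<close>)
    qed
    show "poly F t \<ge> - exp (real n * (2 / 3 * t\<^sup>2 - 2))" if t: "\<bar>t\<bar> \<ge> 2"
    proof -
      define g where "g = 2 / 3 * t\<^sup>2 - 2"
      have "\<bar>2 :: real\<bar> \<le> \<bar>t\<bar>" using t by simp
      then have t2: "t\<^sup>2 \<ge> 4" by (subst (asm) abs_le_square_iff) simp
      then have g: "g \<ge> 0" by (simp add: g_def)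
      have factor: "\<bar>t\<^sup>2 - y\<^sup>2\<bar> / (y\<^sup>2 - s\<^sup>2) \<le> exp (2 / 3 * g)" if "y \<in> Z" for y
      proof (cases "t\<^sup>2 \<le> y\<^sup>2")
        case True
        then have "\<bar>t\<^sup>2 - y\<^sup>2\<bar> / (y\<^sup>2 - s\<^sup>2) \<le> 1" using t2 z2[OF that] by (simp add: s2)
        then show ?thesis by (rule order_trans) (use g in simp)
      next
        case False
        have "0 \<le> (y\<^sup>2 - 4) * (t\<^sup>2 - s\<^sup>2)"
          using t2 z2[OF that] by (intro mult_nonneg_nonneg) (auto simp: s2)
        \<comment> \<open>The extreme case is \<open>y^2 = 4\<close>, where
          \<open>y^2 - s^2 = 111 / 100\<close>.\<close>
        moreover have "100 / 111 * (t\<^sup>2 - 4) * (y\<^sup>2 - s\<^sup>2) - (t\<^sup>2 - y\<^sup>2) = 100 / 111 * ((y\<^sup>2 - 4) * (t\<^sup>2 - s\<^sup>2))"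
          by (simp add: s2 field_simps)
        ultimately have "t\<^sup>2 - y\<^sup>2 \<le> 100 / 111 * (t\<^sup>2 - 4) * (y\<^sup>2 - s\<^sup>2)" by linarith
        then have "\<bar>t\<^sup>2 - y\<^sup>2\<bar> / (y\<^sup>2 - s\<^sup>2) \<le> 100 / 111 * (t\<^sup>2 - 4)"
          using False z2[OF that] by (subst pos_divide_le_eq) (auto simp: s2)
        also have "\<dots> \<le> exp (2 / 5 * (100 / 111 * (t\<^sup>2 - 4)))" by (rule le_exp_two_fifths)
        also have "\<dots> \<le> exp (2 / 3 * g)" using t2 by (simp add: g_def)
        finally show ?thesis .
      qed
      have "(poly F t)\<^sup>2 \<le> (\<Prod>y\<in>Z. exp (2 / 3 * g))"
        unfolding F_square using factor z2 by (intro prod_mono) (force simp: s2)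
      also have "\<dots> = exp (real (card Z) * (2 / 3 * g))"
        by (simp flip: exp_of_nat_mult)
      also have "\<dots> \<le> exp (2 * (real n * g))"
      proof -
        have "real (card Z) * (2 / 3 * g) \<le> real (3 * n) * (2 / 3 * g)"
          using Z g by (intro mult_right_mono of_nat_mono) auto
        then show ?thesis by simp
      qed
      also have "\<dots> = (exp (real n * g))\<^sup>2" by (simp add: exp_double)
      finally have "\<bar>poly F t\<bar> \<le> exp (real n * g)"
        using abs_le_square_iff[of "poly F t" "exp (real n * g)"] by simp
      then show ?thesis by (simp add: g_def)
    qed
  qed
  then show ?thesis by (auto simp: F_def mean_smult R_def)
qed

end

subsection \<open>Orthogonality and symmetry\<close>

abbreviation shift :: "real \<Rightarrow> real poly \<Rightarrow> real poly" where
  "shift a f \<equiv> f \<circ>\<^sub>p [:a, 1:]"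

lemma higher_pderiv_shift: "(pderiv ^^ j) (shift a f) = shift a ((pderiv ^^ j) f)"
  by (induction j) (simp_all add: pderiv_pcompose pderiv_pCons)

lemma shift_prod_linear: "shift a (\<Prod>i\<in>I. [:- y i, 1:]) = (\<Prod>i\<in>I. [:- (y i - a), 1:])"
  by (simp add: pcompose_prod pcompose_pCons)

lemma degree_prod_linear: "degree (\<Prod>i\<in>I. [:- y i, 1 :: real:]) = card I"
  by (subst degree_prod_eq_sum_degree) auto

lemma prod_linear_nonzero: "(\<Prod>i\<in>I. [:- y i, 1 :: real:]) \<noteq> 0"
  by (cases "finite I") auto

lemma order_ge_higher_pderiv:
  fixes s :: "real poly"
  assumes "s \<noteq> 0" "\<And>j. j < m \<Longrightarrow> poly ((pderiv ^^ j) s) b = 0"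
  shows "m \<le> order b s"
  using assms
proof (induction m arbitrary: s)
  case (Suc m)
  have root: "poly s b = 0" using Suc.prems(2)[of 0] by simp
  have "pderiv s \<noteq> 0"
  proof
    assume "pderiv s = 0"
    then obtain h where "s = [:h:]" using pderiv_iszero by blast
    then show False using root Suc.prems(1) by simp
  qed
  moreover have "poly ((pderiv ^^ j) (pderiv s)) b = 0" if "j < m" for j
    using Suc.prems(2)[of "Suc j"] that by (simp add: funpow_swap1)
  ultimately have "m \<le> order b (pderiv s)" by (rule Suc.IH)
  then show ?case using order_pderiv[OF Suc.prems(1) root] by simp
qed simp

context gaussian_weight
begin

lemma weight_minus: "weight (- t) = weight t"
  by (simp add: weight_def)

lemma mean_reflect: "mean (f \<circ>\<^sub>p [:0, - 1:]) = mean f"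
  unfolding mean_def
  by (subst (2) lborel_integral_real_affine[of "-1" _ 0]) (simp_all add: poly_pcompose weight_minus)

text \<open>The shift adds \<open>b\<close> to the raising operator, and by Stein's identity the
  remaining two terms cancel in the mean.\<close>

lemma mean_shift_hermite: "mean (shift b (hermite k)) = b ^ k"
proof (induction k)
  case (Suc k)
  have "shift b (hermite (Suc k)) = smult b (shift b (hermite k)) + pCons 0 (shift b (hermite k))
      - smult (1 / (2 * N)) (pderiv (shift b (hermite k)))"
    by (simp add: pcompose_diff pcompose_smult pcompose_pCons pderiv_pcompose pderiv_pCons)
  then show ?case
    by (simp add: mean_add mean_diff mean_smult mean_pCons_0 Suc)
qed (simp add: pcompose_1)

lemma mean_shift_higher_pderiv_hermite:
  "mean (shift b ((pderiv ^^ j) (hermite k))) = poly ((pderiv ^^ j) (monom 1 k)) b"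
proof (induction j arbitrary: k)
  case 0
  then show ?case by (simp add: mean_shift_hermite poly_monom)
next
  case (Suc j)
  show ?case
  proof (cases k)
    case 0
    then show ?thesis by (simp add: funpow_swap1 pderiv_monom)
  next
    case (Suc i)
    have "pderiv (monom (1 :: real) k) = smult (real k) (monom 1 i)"
      by (simp add: Suc pderiv_monom smult_monom)
    then show ?thesis
      using Suc.IH
      by (simp only: funpow_Suc_right o_apply Suc pderiv_hermite_Suc higher_pderiv_smult pcompose_smult
          mean_smult poly_smult)
  qed
qed

text \<open>
  A polynomial that is orthogonal to degree \<open>< m\<close> for the weight centred at \<open>b\<close> is mapped by the
  heat flow (\<open>hermite k\<close> to \<open>x ^ k\<close>) to one that vanishes at \<open>b\<close> to order \<open>m\<close>.
\<close>

lemma orthogonal_three_centres_eq_0: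
  assumes deg: "degree Q < 3 * m" and C: "card C = 3"
    and orth: "\<And>b B. b \<in> C \<Longrightarrow> degree B < m \<Longrightarrow> mean (shift b (B * Q)) = 0"
  shows "Q = 0"
proof -
  obtain g where g: "Q = (\<Sum>k\<le>degree Q. smult (g k) (hermite k))"
    using hermite_expansion[of Q "degree Q"] by blast
  define s where "s = (\<Sum>k\<le>degree Q. monom (g k) k)"
  have deriv: "mean (shift b ((pderiv ^^ j) Q)) = poly ((pderiv ^^ j) s) b" for b j
  proof -
    have "mean (shift b ((pderiv ^^ j) Q)) =
        (\<Sum>k\<le>degree Q. g k * mean (shift b ((pderiv ^^ j) (hermite k))))"
      by (subst g) (simp add: higher_pderiv_sum higher_pderiv_smult pcompose_sum pcompose_smult
          mean_sum mean_smult)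
    also have "\<dots> = poly ((pderiv ^^ j) (\<Sum>k\<le>degree Q. smult (g k) (monom 1 k))) b"
      by (simp add: mean_shift_higher_pderiv_hermite higher_pderiv_sum higher_pderiv_smult poly_sum
          del: smult_monom)
    also have "(\<Sum>k\<le>degree Q. smult (g k) (monom 1 k)) = s"
      by (simp add: s_def smult_monom)
    finally show ?thesis .
  qed
  have zero: "poly ((pderiv ^^ j) s) b = 0" if "b \<in> C" "j < m" for b j
  proof -
    \<comment> \<open>Testing with \<open>hermite j\<close> moved to the centre \<open>b\<close>
      extracts the \<open>j\<close>-th derivative at \<open>b\<close>.\<close>
    have "degree (shift (- b) (hermite j)) < m"
      using degree_hermite_le[of j] that by (simp add: degree_pcompose)
    from orth[OF that(1) this]
    have "mean (shift b Q * hermite j) = 0"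
      by (simp add: pcompose_mult mult.commute pcompose_pCons flip: pcompose_assoc)
    then show ?thesis
      using N_pos by (simp add: mean_mult_hermite higher_pderiv_shift deriv)
  qed
  have "s = 0"
  proof (rule ccontr)
    assume s: "s \<noteq> 0"
    have "finite C" using C card.infinite by fastforce
    \<comment> \<open>Counted with multiplicity, \<open>s\<close> would have at least
      \<open>3 * m\<close> zeros, more than its degree allows.\<close>
    have "3 * m = (\<Sum>b\<in>C. m)" using C by simp
    also have "\<dots> \<le> (\<Sum>b\<in>C. order b s)"
      using order_ge_higher_pderiv[OF s zero] by (intro sum_mono) auto
    also have "\<dots> = (\<Sum>b\<in>C. count (proots s) b)" using s by simp
    also have "\<dots> = size (filter_mset (\<lambda>b. b \<in> C) (proots s))"
    proof -
      have "size (filter_mset (\<lambda>b. b \<in> C) (proots s)) =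
        (\<Sum>b\<in>set_mset (filter_mset (\<lambda>b. b \<in> C) (proots s)). count (filter_mset (\<lambda>b. b \<in> C) (proots s)) b)"
        by (simp add: size_multiset_overloaded_eq)
      also have "\<dots> = (\<Sum>b\<in>C. count (filter_mset (\<lambda>b. b \<in> C) (proots s)) b)"
        using \<open>finite C\<close> by (intro sum.mono_neutral_left) (auto simp: count_eq_zero_iff)
      finally show ?thesis by simp
    qed
    also have "\<dots> \<le> size (proots s)" by (rule size_filter_mset_lesseq)
    also have "\<dots> \<le> degree s" by (rule size_proots_le)
    also have "degree s \<le> degree Q"
      unfolding s_def by (intro degree_sum_le) (auto intro: order_trans[OF degree_monom_le])
    finally show False using deg by simp
  qed
  \<comment> \<open>The heat flow loses nothing: \<open>s\<close> carries the Hermite coefficients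
    of \<open>Q\<close>.\<close>
  moreover have "coeff s k = g k" if "k \<le> degree Q" for k
    using that by (simp add: s_def coeff_sum)
  ultimately have "g k = 0" if "k \<le> degree Q" for k
    using that by simp
  then show ?thesis by (subst g) simp
qed

end

context scaled_gaussian
begin

section \<open>From the three potentials to centred Gaussian means\<close>

lemma integral_shifted_weight:
  "(LINT x|lborel. poly f x * exp (- real n * ((x - b)\<^sup>2 - b\<^sup>2))) =
     exp (real n * b\<^sup>2) / sqrt (real n / pi) * mean (shift b f)"
proof -
  have eq: "poly f (b + 1 * t) * exp (- real n * ((b + 1 * t - b)\<^sup>2 - b\<^sup>2)) =
      exp (real n * b\<^sup>2) / sqrt (real n / pi) * (poly (shift b f) t * weight t)" for t
    using n_pos
    by (simp add: weight_def poly_pcompose algebra_simps flip: exp_add)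
  show ?thesis
    unfolding mean_def
    by (subst lborel_integral_real_affine[of 1 _ b]) (simp_all only: eq, simp_all)
qed

text \<open>Completing the square; the zeros in the middle case give all three the common form
  \<open>(x - b)^2 - b^2\<close>.\<close>

lemma potential_eq:
  "potential c 1 x = (x - (- c / 2))\<^sup>2 - (- c / 2)\<^sup>2"
  "potential c 2 x = (x - 0)\<^sup>2 - 0\<^sup>2"
  "potential c 3 x = (x - c / 2)\<^sup>2 - (c / 2)\<^sup>2"
  by (simp_all add: potential_def power2_eq_square field_simps)

lemma hermite_orthogonal:
  assumes P: "scaled_multiple_hermite c n P" and b: "b \<in> {- c / 2, 0, c / 2}" and B: "degree B < n"
  shows "mean (shift b (B * P)) = 0"
proof -
  have "mean (shift b (monom 1 k * P)) = 0" if k: "k < n" for k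
  proof -
    have "\<exists>j\<in>{1..3}. \<forall>x. potential c j x = (x - b)\<^sup>2 - b\<^sup>2"
      using b potential_eq by fastforce
    then obtain j where j: "j \<in> {1..3}" "\<And>x. potential c j x = (x - b)\<^sup>2 - b\<^sup>2" by blast
    then have "(LINT x|lborel. x ^ k * poly P x * exp (- real n * ((x - b)\<^sup>2 - b\<^sup>2))) = 0"
      unfolding j(2)[symmetric] using P k by (simp add: scaled_multiple_hermite_def)
    then have "(LINT x|lborel. poly (monom 1 k * P) x * exp (- real n * ((x - b)\<^sup>2 - b\<^sup>2))) = 0"
      by (simp add: poly_monom)
    then show ?thesis
      unfolding integral_shifted_weight using n_pos by simp
  qed
  then have "(\<Sum>k<n. coeff B k * mean (shift b (monom 1 k * P))) = 0" by simp
  also have "(\<Sum>k<n. coeff B k * mean (shift b (monom 1 k * P))) =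
      mean (shift b ((\<Sum>k<n. monom (coeff B k) k) * P))"
    by (simp add: sum_distrib_right pcompose_sum mean_sum flip: mean_smult pcompose_smult mult_smult_left)
      (simp add: smult_monom)
  also have "(\<Sum>k<n. monom (coeff B k) k) = B"
    using poly_as_sum_of_monoms'[of B "n - 1"] B n_pos
    by (cases n) (simp_all add: lessThan_Suc_atMost)
  finally show ?thesis .
qed

text \<open>The reflection of \<open>P\<close>, made monic by the sign
  \<open>(- 1) ^ n = (- 1) ^ (3 * n)\<close>, satisfies the same orthogonality since the centres are
  symmetric. The difference has degree below \<open>3 * n\<close>, so it vanishes.\<close>

lemma hermite_symmetric:
  assumes P: "scaled_multiple_hermite c n P" and c: "c > 0"
  shows "poly P (- z) = (- 1) ^ n * poly P z"
proof -
  define P' where "P' = smult ((- 1) ^ n) (P \<circ>\<^sub>p [:0, - 1:])"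
  have deg: "degree P = 3 * n" using P by (simp add: scaled_multiple_hermite_def)
  have "degree (P - P') < 3 * n"
  proof (rule degree_lessI)
    show "P - P' \<noteq> 0 \<or> 3 * n > 0" using n_pos by simp
    show "\<forall>k\<ge>3 * n. coeff (P - P') k = 0"
    proof (intro allI impI)
      fix k assume "3 * n \<le> k"
      then consider "k = 3 * n" | "k > degree P" using deg by linarith
      then show "coeff (P - P') k = 0"
      proof cases
        case 1
        have "(- 1 :: real) ^ n * (- 1) ^ (3 * n) = 1"
          by (simp flip: power_add)
        then show ?thesis by (simp add: 1 P'_def coeff_pcompose_linear mult.assoc[symmetric])
      qed (simp add: P'_def coeff_pcompose_linear coeff_eq_0)
    qed
  qed
  moreover have "card {- c / 2, 0, c / 2} = 3" using c by simp
  moreover have "mean (shift b (B * (P - P'))) = 0" if b: "b \<in> {- c / 2, 0, c / 2}" and B: "degree B < n" for b B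
  proof -
    have "shift b (B * (P \<circ>\<^sub>p [:0, - 1:])) = shift (- b) ((B \<circ>\<^sub>p [:0, - 1:]) * P) \<circ>\<^sub>p [:0, - 1:]"
      by (intro poly_eq_poly_eq_iff[THEN iffD1] ext) (simp add: poly_pcompose add.commute)
    moreover have "mean (shift (- b) ((B \<circ>\<^sub>p [:0, - 1:]) * P)) = 0"
      using b B by (intro hermite_orthogonal[OF P]) (auto simp: degree_pcompose)
    ultimately have "mean (shift b (B * P')) = 0"
      by (simp only: P'_def mult_smult_right pcompose_smult mean_smult mean_reflect)
    then show ?thesis
      using hermite_orthogonal[OF P b B] by (simp add: right_diff_distrib pcompose_diff mean_diff)
  qed
  ultimately have "P - P' = 0" by (rule orthogonal_three_centres_eq_0)
  then have "poly P (- z) = poly P' (- z)" by simp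
  then show ?thesis by (simp add: P'_def poly_pcompose)
qed

end

subsection \<open>Location of the zeros and signs of the weights\<close>

lemma monic_eq_prod_roots:
  fixes P :: "real poly"
  assumes "lead_coeff P = 1" "card {z. poly P z = 0} = degree P"
  shows "P = (\<Prod>z\<in>{z. poly P z = 0}. [:- z, 1:])"
proof (rule poly_eqI_degree_lead_coeff[where n = "degree P" and A = "{z. poly P z = 0}"])
  have "P \<noteq> 0" using assms(1) by auto
  then have "finite {z. poly P z = 0}" by (rule poly_roots_finite)
  then show "poly P z = poly (\<Prod>z\<in>{z. poly P z = 0}. [:- z, 1:]) z" if "z \<in> {z. poly P z = 0}" for z
    using that by (auto simp: poly_prod intro!: prod_zero[symmetric])
  show "coeff P (degree P) = coeff (\<Prod>z\<in>{z. poly P z = 0}. [:- z, 1:]) (degree P)"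
    using assms lead_coeff_prod[of "\<lambda>z. [:- z, 1 :: real:]" "{z. poly P z = 0}"]
    by (simp add: degree_prod_linear)
qed (use assms in \<open>simp_all add: degree_prod_linear\<close>)

context scaled_gaussian
begin

context
  fixes c :: real and P :: "real poly"
  assumes c: "c > 8" and P: "scaled_multiple_hermite c n P"
    and roots: "card {z. poly P z = 0} = 3 * n"
begin

definition zeros :: "real set" where
  "zeros = {z. poly P z = 0}"

lemma zeros_finite: "finite zeros"
  using roots n_pos card.infinite[of zeros] by (auto simp: zeros_def)

lemma P_eq_prod: "P = (\<Prod>z\<in>S. [:- z, 1:]) * (\<Prod>z\<in>zeros - S. [:- z, 1:])" if "S \<subseteq> zeros" for S
proof -
  have "P = (\<Prod>z\<in>zeros. [:- z, 1:])"
    unfolding zeros_def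
    by (rule monic_eq_prod_roots) (use P roots in \<open>auto simp: scaled_multiple_hermite_def\<close>)
  also have "\<dots> = (\<Prod>z\<in>S. [:- z, 1:]) * (\<Prod>z\<in>zeros - S. [:- z, 1:])"
    using zeros_finite that by (simp add: prod.subset_diff mult.commute)
  finally show ?thesis .
qed

lemma few_zeros_orthogonal:
  assumes S: "S \<subseteq> zeros" "card S < n" and b: "b \<in> {- c / 2, 0, c / 2}"
  shows "mean ((\<Prod>z\<in>S. [:- (z - b), 1:])\<^sup>2 * (\<Prod>z\<in>zeros - S. [:- (z - b), 1:])) = 0"
proof -
  have "mean (shift b ((\<Prod>z\<in>S. [:- z, 1:]) * P)) = 0"
    using S b by (intro hermite_orthogonal[OF P]) (simp_all add: degree_prod_linear)
  then show ?thesis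
    by (subst (asm) P_eq_prod[OF S(1)])
      (simp only: pcompose_mult shift_prod_linear power2_eq_square mult.assoc)
qed

lemma card_zeros_diff_le: "card (zeros - S) \<le> 3 * n"
  using zeros_finite roots card_mono[of zeros "zeros - S"] by (auto simp: zeros_def)

lemma zeros_uminus: "- z \<in> zeros \<longleftrightarrow> z \<in> zeros"
  using hermite_symmetric[OF P, of z] c by (simp add: zeros_def)

lemma card_left_zeros_ge: "card {z \<in> zeros. z < 2 - c / 2} \<ge> n"
proof (rule ccontr)
  define S where "S = {z \<in> zeros. z < 2 - c / 2}"
  assume "\<not> ?thesis"
  then have S: "S \<subseteq> zeros" "card S < n" by (auto simp: S_def)
  \<comment> \<open>Seen from \<open>- c / 2\<close>, every zero outside \<open>S\<close> lies at
    \<open>2\<close> or beyond, so this mean is strictly signed, against orthogonality.\<close>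
  have "(- 1) ^ card (zeros - S) *
      mean ((\<Prod>z\<in>S. [:- (z - (- c / 2)), 1:])\<^sup>2 * (\<Prod>z\<in>zeros - S. [:- (z - (- c / 2)), 1:])) > 0"
  proof (rule mean_square_mult_prod_right[OF prod_linear_nonzero])
    show "degree (\<Prod>z\<in>S. [:- (z - (- c / 2)), 1:]) \<le> n"
      unfolding degree_prod_linear using S by simp
  qed (use zeros_finite card_zeros_diff_le in \<open>auto simp: S_def\<close>)
  then show False using few_zeros_orthogonal[OF S, of "- c / 2"] by simp
qed

lemma card_right_zeros_ge: "card {z \<in> zeros. z > c / 2 - 2} \<ge> n"
proof -
  have "bij_betw uminus {z \<in> zeros. z < 2 - c / 2} {z \<in> zeros. z > c / 2 - 2}"
    by (rule bij_betw_byWitness[where f' = uminus]) (auto simp: zeros_uminus)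
  then show ?thesis using card_left_zeros_ge by (simp add: bij_betw_same_card)
qed

lemma card_middle_zeros_ge: "card {z \<in> zeros. \<bar>z\<bar> < 2} \<ge> n"
proof (rule ccontr)
  define S where "S = {z \<in> zeros. \<bar>z\<bar> < 2}"
  assume "\<not> ?thesis"
  then have S: "S \<subseteq> zeros" "card S < n" by (auto simp: S_def)
  have "uminus ` (zeros - S) = zeros - S"
  proof (intro equalityI subsetI)
    fix z assume "z \<in> zeros - S"
    then have "- z \<in> zeros - S" by (simp add: S_def zeros_uminus)
    then show "z \<in> uminus ` (zeros - S)" by (rule image_eqI[rotated]) simp
  qed (auto simp: S_def zeros_uminus)
  then have "mean ((\<Prod>z\<in>S. [:- z, 1:])\<^sup>2 * (\<Prod>z\<in>zeros - S. [:- z, 1:])) \<noteq> 0"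
  proof (intro mean_square_mult_prod_symmetric[OF prod_linear_nonzero])
    show "degree (\<Prod>z\<in>S. [:- z, 1:]) \<le> n"
      unfolding degree_prod_linear using S by simp
  qed (use zeros_finite card_zeros_diff_le in \<open>auto simp: S_def\<close>)
  then show False using few_zeros_orthogonal[OF S, of 0] by simp
qed

text \<open>Since \<open>c / 2 - 2 > 2\<close>, the three regions are disjoint, and the other two
  already use up \<open>2 * n\<close> of the \<open>3 * n\<close> zeros.\<close>

lemma card_left_zeros_le: "card {z \<in> zeros. z < 2 - c / 2} \<le> n"
proof -
  let ?L = "{z \<in> zeros. z < 2 - c / 2}" and ?M = "{z \<in> zeros. \<bar>z\<bar> < 2}"
    and ?R = "{z \<in> zeros. z > c / 2 - 2}"
  have "(?L \<union> ?M) \<inter> ?R = {}" "?L \<inter> ?M = {}"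
    using c by auto
  then have "card ?L + card ?M + card ?R = card (?L \<union> ?M \<union> ?R)"
    using zeros_finite by (simp add: card_Un_disjoint)
  also have "\<dots> \<le> 3 * n"
    unfolding roots[folded zeros_def, symmetric] by (rule card_mono[OF zeros_finite]) auto
  finally show ?thesis using card_middle_zeros_ge card_right_zeros_ge by linarith
qed

text \<open>Otherwise the first \<open>n + 1\<close> zeros would all lie in the left region.\<close>

lemma later_zeros_ge:
  assumes x: "ordered_zeros P (3 * n) x" and i: "i \<in> {n + 1..3 * n}"
  shows "x i + c / 2 \<ge> 2"
proof (rule ccontr)
  assume "\<not> ?thesis"
  then have less: "x i < 2 - c / 2" by simp
  have mono: "strict_mono_on {1..3 * n} x" and image: "x ` {1..3 * n} = zeros"
    using x by (auto simp: ordered_zeros_def zeros_def)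
  have "x ` {1..n + 1} \<subseteq> {z \<in> zeros. z < 2 - c / 2}"
  proof (rule image_subsetI, rule CollectI, rule conjI)
    fix j assume j: "j \<in> {1..n + 1}"
    then have "x j \<le> x i"
      using strict_mono_on_leD[OF mono, of j i] i by simp
    then show "x j < 2 - c / 2" using less by simp
    have "j \<in> {1..3 * n}" using i j by simp
    then show "x j \<in> zeros" using image by blast
  qed
  then have "card (x ` {1..n + 1}) \<le> card {z \<in> zeros. z < 2 - c / 2}"
    by (rule card_mono[rotated]) (use zeros_finite in simp)
  then have "card (x ` {1..n + 1}) \<le> n"
    using card_left_zeros_le by linarith
  moreover have "inj_on x {1..n + 1}"
    using i by (intro inj_on_subset[OF strict_mono_on_imp_inj_on[OF mono]]) auto
  ultimately show False by (simp add: card_image)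
qed

end

section \<open>Weights from test polynomials\<close>

lemma quadrature_exact:
  assumes "first_quadrature_weights c n x w" "degree f \<le> 4 * n - 1"
  shows "(\<Sum>k = 1..3 * n. w k * poly f (x k)) =
    exp (real n * (- c / 2)\<^sup>2) / sqrt (real n / pi) * mean (shift (- c / 2) f)"
proof -
  have "(LINT t|lborel. poly f t * exp (- real n * ((t - (- c / 2))\<^sup>2 - (- c / 2)\<^sup>2))) =
      (\<Sum>k = 1..3 * n. w k * poly f (x k))"
    unfolding potential_eq(1)[symmetric] using assms by (simp add: first_quadrature_weights_def)
  then show ?thesis unfolding integral_shifted_weight by simp
qed

text \<open>The polynomial \<open>A^2 * R\<close> vanishes at all nodes except \<open>x k\<close>,
  so the rule isolates \<open>w k\<close>. Squaring the factors from \<open>I\<close> is what the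
  degree of exactness beyond \<open>3 * n - 1\<close> pays for.\<close>

lemma quadrature_weight_sign:
  assumes w: "first_quadrature_weights c n x w"
    and k: "k \<in> {1..3 * n}" "I \<union> J = {1..3 * n} - {k}"
    and I: "finite I" "card I \<le> n" and J: "finite J" "\<And>j. j \<in> J \<Longrightarrow> x j + c / 2 \<ge> 2"
    and deg: "2 * card I + card J \<le> 4 * n - 1"
  shows "(- 1) ^ card J * (w k * ((\<Prod>i\<in>I. x k - x i)\<^sup>2 * (\<Prod>j\<in>J. x k - x j))) > 0"
proof -
  define A where "A = (\<Prod>i\<in>I. [:- x i, 1:])"
  define R where "R = (\<Prod>j\<in>J. [:- x j, 1:])"
  have vanish: "poly (A\<^sup>2 * R) (x i) = 0" if "i \<in> {1..3 * n} - {k}" for i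
  proof -
    have "i \<in> I \<or> i \<in> J" using that k(2) by blast
    then show ?thesis using I J by (auto simp: A_def R_def poly_prod)
  qed
  have "degree (A\<^sup>2 * R) \<le> 2 * card I + card J"
    unfolding A_def R_def
    by (rule order_trans[OF degree_mult_le add_mono[OF order_trans[OF degree_power_le]]])
      (simp_all add: degree_prod_linear)
  then have exact: "(\<Sum>i = 1..3 * n. w i * poly (A\<^sup>2 * R) (x i)) =
      exp (real n * (- c / 2)\<^sup>2) / sqrt (real n / pi) * mean (shift (- c / 2) (A\<^sup>2 * R))"
    using deg by (intro quadrature_exact[OF w]) simp
  have "(\<Sum>i = 1..3 * n. w i * poly (A\<^sup>2 * R) (x i)) = w k * poly (A\<^sup>2 * R) (x k)"
    using k vanish by (subst sum.remove[of _ k]) (auto intro!: sum.neutral simp del: poly_mult)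
  also have "poly (A\<^sup>2 * R) (x k) = (\<Prod>i\<in>I. x k - x i)\<^sup>2 * (\<Prod>j\<in>J. x k - x j)"
    by (simp add: A_def R_def poly_prod)
  finally have sum: "w k * ((\<Prod>i\<in>I. x k - x i)\<^sup>2 * (\<Prod>j\<in>J. x k - x j)) =
      exp (real n * (- c / 2)\<^sup>2) / sqrt (real n / pi) * mean (shift (- c / 2) (A\<^sup>2 * R))"
    using exact by simp
  have "J \<subseteq> {1..3 * n}" using k by blast
  then have "card J \<le> 3 * n" using card_mono[of "{1..3 * n}" J] by simp
  then have "(- 1) ^ card J * mean ((\<Prod>i\<in>I. [:- (x i - (- c / 2)), 1:])\<^sup>2 *
      (\<Prod>j\<in>J. [:- (x j - (- c / 2)), 1:])) > 0"
  proof (intro mean_square_mult_prod_right[OF prod_linear_nonzero])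
    show "degree (\<Prod>i\<in>I. [:- (x i - (- c / 2)), 1:]) \<le> n"
      unfolding degree_prod_linear using I by simp
  qed (use J in auto)
  also have "(\<Prod>i\<in>I. [:- (x i - (- c / 2)), 1:])\<^sup>2 * (\<Prod>j\<in>J. [:- (x j - (- c / 2)), 1:]) =
      shift (- c / 2) (A\<^sup>2 * R)"
    by (simp only: A_def R_def pcompose_mult shift_prod_linear power2_eq_square)
  finally have "exp (real n * (- c / 2)\<^sup>2) / sqrt (real n / pi) *
      ((- 1) ^ card J * mean (shift (- c / 2) (A\<^sup>2 * R))) > 0"
    by (rule mult_pos_pos[rotated]) (use n_pos in simp)
  then show ?thesis unfolding sum by (simp only: mult_ac)
qed

end

lemma sgn_prod: "sgn (prod f A) = (\<Prod>x\<in>A. sgn (f x))" for f :: "'a \<Rightarrow> real"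
  by (induction A rule: infinite_finite_induct) (simp_all add: sgn_mult)

theorem theorem5p4:
  fixes c :: real and n :: nat and P :: "real poly" and x w :: "nat \<Rightarrow> real"
  assumes "c > 8" and "n \<ge> 1"
    and "scaled_multiple_hermite c n P"
    and "ordered_zeros P (3 * n) x"
    and "first_quadrature_weights c n x w"
  shows "(\<forall>k\<in>{1..n}. w k > 0) \<and>
         (\<forall>k\<in>{n + 1..3 * n}. sgn (w k) = (- 1) ^ (k - n + 1))"
proof -
  interpret scaled_gaussian n using assms(2) by unfold_locales
  have mono: "strict_mono_on {1..3 * n} x" and image: "x ` {1..3 * n} = {z. poly P z = 0}"
    using assms(4) by (auto simp: ordered_zeros_def)
  have "card {z. poly P z = 0} = 3 * n"
    unfolding image[symmetric] card_image[OF strict_mono_on_imp_inj_on[OF mono]] by simp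
  note later = later_zeros_ge[OF assms(1,3) this assms(4)]
  have less: "x i < x j" if "i < j" "1 \<le> i" "j \<le> 3 * n" for i j
    using strict_mono_onD[OF mono, of i j] that by simp
  show ?thesis
  proof (intro conjI ballI)
    fix k assume k: "k \<in> {1..n}"
    define p where "p = (\<Prod>j\<in>{n + 1..3 * n}. x k - x j)"
    define q where "q = (\<Prod>i\<in>{1..n} - {k}. x k - x i)"
    \<comment> \<open>The test polynomial has degree \<open>2 * (n - 1) + 2 * n = 4 * n - 2\<close>,
      and the leading sign is even.\<close>
    have "(- 1) ^ card {n + 1..3 * n} * (w k * (q\<^sup>2 * p)) > 0"
      unfolding p_def q_def using assms(5)
      by (rule quadrature_weight_sign) (use k later in auto)
    moreover have "p = (- 1) ^ card {n + 1..3 * n} * (\<Prod>j\<in>{n + 1..3 * n}. x j - x k)"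
    proof -
      have "p = (\<Prod>j\<in>{n + 1..3 * n}. - 1 * (x j - x k))" by (simp add: p_def)
      then show ?thesis by (simp only: prod.distrib prod_constant)
    qed
    then have "p > 0" using k less by (auto intro!: prod_pos)
    then have "q\<^sup>2 * p \<ge> 0" by simp
    ultimately show "w k > 0" by (auto simp: zero_less_mult_iff)
  next
    fix k assume k: "k \<in> {n + 1..3 * n}"
    define J where "J = {n + 1..3 * n} - {k}"
    define q where "q = (\<Prod>i\<in>{1..n}. x k - x i)"
    define p where "p = (\<Prod>j\<in>J. x k - x j)"
    have card_J: "card J = 2 * n - 1" using k by (simp add: J_def)
    \<comment> \<open>Now the degree is \<open>2 * n + (2 * n - 1)\<close>, exactly the limit of
      exactness, and \<open>card J\<close> is odd.\<close>
    have "(- 1) ^ card J * (w k * (q\<^sup>2 * p)) > 0"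
      unfolding p_def q_def using assms(5)
      by (rule quadrature_weight_sign) (use k later assms(2) card_J in \<open>auto simp: J_def\<close>)
    then have neg: "w k * (q\<^sup>2 * p) < 0"
      using assms(2) by (simp add: card_J)
    then have "q\<^sup>2 > 0" by auto
    moreover have "sgn (w k * (q\<^sup>2 * p)) = - 1"
      using neg by (rule sgn_neg)
    ultimately have "sgn (w k) * sgn p = - 1"
      by (simp only: sgn_mult sgn_pos mult_1_left)
    \<comment> \<open>Only the \<open>3 * n - k\<close> nodes to the right of \<open>x k\<close>
      contribute negative factors.\<close>
    moreover have "sgn p = (- 1) ^ (3 * n - k)"
    proof -
      have "J = {n + 1..<k} \<union> {k + 1..3 * n}" using k by (auto simp: J_def)
      then have "sgn p = (\<Prod>j\<in>{n + 1..<k}. sgn (x k - x j)) * (\<Prod>j\<in>{k + 1..3 * n}. sgn (x k - x j))"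
        unfolding p_def sgn_prod by (subst prod.union_disjoint[symmetric]) auto
      also have "(\<Prod>j\<in>{n + 1..<k}. sgn (x k - x j)) = 1"
      proof (intro prod.neutral ballI)
        fix j assume "j \<in> {n + 1..<k}"
        then show "sgn (x k - x j) = 1" using less[of j k] k by simp
      qed
      also have "(\<Prod>j\<in>{k + 1..3 * n}. sgn (x k - x j)) = (\<Prod>j\<in>{k + 1..3 * n}. - 1)"
      proof (rule prod.cong)
        fix j assume "j \<in> {k + 1..3 * n}"
        then show "sgn (x k - x j) = - 1" using less[of k j] k by simp
      qed simp
      finally show ?thesis by simp
    qed
    ultimately have "sgn (w k) * (- 1) ^ (3 * n - k) = - 1" by simp
    moreover have "(- 1 :: real) ^ (3 * n - k) * (- 1) ^ (3 * n - k) = 1"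
      by (simp flip: power_add)
    ultimately have "sgn (w k) = - ((- 1) ^ (3 * n - k))"
      by (metis mult.assoc mult.right_neutral mult_minus1)
    also have "\<dots> = (- 1) ^ (k - n + 1)"
    proof -
      \<comment> \<open>The two exponents differ by \<open>4 * n - 2 * k\<close>.\<close>
      have "even (3 * n - k) \<longleftrightarrow> even (k - n)" using k by (auto simp: even_diff_nat)
      then show ?thesis by (simp add: minus_one_power_iff)
    qed
    finally show "sgn (w k) = (- 1) ^ (k - n + 1)" .
  qed
qed

end
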